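(* Let $X$ be a generic Hopf surface given by the contraction $(x,y)\mapsto(ax,by)$ with $|a|\le|b|$. Below, $H\in\mathrm{Pic}(X)$ with $\deg(H)\le 0$ and all Higgs fields are trace-free. (1) The nowhere-vanishing $L_a$-twisted Higgs bundles of the form $(\mathcal{O}_X\oplus H,\phi)$, up to conjugation by an automorphism of $\mathcal{O}_X\oplus H$, are as follows: (a) $H\simeq L_a^{-1}$ and $\phi=\begin{pmatrix}0&tx^2\\1&0\end{pmatrix}$ for some $t\in\mathbb{C}$. The $\phi$-invariant sub-line bundles are $L_a^{-1}$ under the inclusions $(\pm x\sqrt t,1)$. (b) $H\simeq L_a\otimes L_b^{-k}$ with $k\ge\frac{\log|a|}{\log|b|}$ an integer and $\phi=\begin{pmatrix}sx&y^k\\0&-sx\end{pmatrix}$ for some $s\in\mathbb{C}^*$. The $\phi$-invariant sub-line bundles are the first direct summand $\mathcal{O}_X$ and $(L_b)^{-k}$ under the inclusion $(y^k,-2sx)$. (c) $H\simeq L_b^k\otimes L_a^{-1}$ with $k$ an integer, $0<k<\frac{\log|a|}{\log|b|}$, and $\phi=\begin{pmatrix}sx&0\\ y^k&-sx\end{pmatrix}$ for some $s\in\mathbb{C}^*$. The $\phi$-invariant sub-line bundles are the second direct summand $H$ and $(L_a)^{-1}$ under the inclusion $(2sx,y^k)$. (2) The nowhere-vanishing $L_b$-twisted Higgs bundles of the form $(\mathcal{O}_X\oplus H,\phi)$, up to conjugation by an automorphism of $\mathcal{O}_X\oplus H$, are as follows: (a) $H\simeq L_b^{-1}$ and $\phi=\begin{pmatrix}0&ty^2\\1&0\end{pmatrix}$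 for some $t\in\mathbb{C}$. The $\phi$-invariant sub-line bundles are $L_b^{-1}$ under the inclusions $(\pm y\sqrt t,1)$. (b) $H\simeq L_b\otimes L_a^{-k}$ with $k>0$ an integer and $\phi=\begin{pmatrix}sy&x^k\\0&-sy\end{pmatrix}$ for some $s\in\mathbb{C}^*$. The $\phi$-invariant sub-line bundles are the first direct summand $\mathcal{O}_X$ and $(L_a)^{-k}$ under the inclusion $(x^k,-2sy)$. (3) If $\ell$ is an integer with $0<\ell<\frac{\log|a|}{\log|b|}$ and $\lambda=L_a\otimes L_b^{-\ell}$, the unique nowhere-vanishing $\lambda$-twisted Higgs bundle of the form $(\mathcal{O}_X\oplus H,\phi)$, up to conjugation by an automorphism of $\mathcal{O}_X\oplus H$, is $$\left(\mathcal{O}_X\oplus(L_b^\ell\otimes L_a^{-1}),\begin{pmatrix}0&0\\1&0\end{pmatrix}\right).$$ This Higgs bundle has $\lambda^{-1}$ as its only $\phi$-invariant sub-line bundle.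
   Context: A generic Hopf surface is $X=(\mathbb{C}^2\setminus\{0\})/\langle F\rangle$ with $F(x,y)=(ax,by)$, $0<|a|\le|b|<1$, and $a^{k_1}\ne b^{k_2}$ for all positive integers $k_1,k_2$. For $\tau\in\mathbb{C}^*$, $L_\tau$ is the line bundle on $X$ obtained from $(\mathbb{C}^2\setminus\{0\})\times\mathbb{C}$ by identifying $(p,v)\sim(F(p),\tau v)$; every line bundle is isomorphic to a unique $L_\tau$. Sections of $L_\tau$ are identified with holomorphic functions $s$ on $\mathbb{C}^2\setminus\{0\}$ with $s\circ F=\tau s$. The degree is $\deg(L_\tau)=\log|\tau|/\log|b|$. A $\lambda$-twisted trace-free Higgs bundle is a pair $(E,\phi)$ with $E$ a rank-2 bundle and $\phi\in H^0(X,\mathcal{E}nd_0(E)\otimes\lambda)$, where $\mathcal{E}nd_0(E)$ denotes trace-free endomorphisms. For $E=\mathcal{O}_X\oplus H$, $\phi$ is written as a matrix $\begin{pmatrix}p&q\\ w&-p\end{pmatrix}$ acting on column vectors, with $p\in H^0(X,\lambda)$, $q\in H^0(X,\lambda\otimes H^{-1})$, $w\in H^0(X,\lambda\otimes H)$. An inclusion $(f,g)$ of a line bundle $M$ means the map $M\to\mathcal{O}_X\oplus H$ with components $f\in H^0(X,M^{-1})$, $g\in H^0(X,M^{-1}\otimes H)$. A sub-line bundle $M$ (taken with torsion-free quotient) is $\phi$-invariant if $\phi(M)\subseteq M\otimes\lambda$. Bundles are considered in the normalized form $\mathcal{O}_X\oplus H$ with $\deg(H)\le0$, obtained by tensoring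 with a line bundle; when $\deg(H)=0$ the bundle $\mathcal{O}_X\oplus H$ can be renormalized, by tensoring with $H^{-1}$, to $\mathcal{O}_X\oplus H^{-1}$, and the two normalizations are identified. Listed Higgs fields are determined by their parameters up to conjugation by automorphisms unless otherwise indicated. *)

theory Defs
  imports "HOL-Analysis.Analysis"
begin

text \<open>
  Everything on \<open>X = (\<complex>\<^sup>2 - {0}) / \<langle>F\<rangle>\<close> is expressed by \<open>F\<close>-equivariant data on \<open>\<complex>\<^sup>2 - {0}\<close>.
  As every line bundle is isomorphic to exactly one \<open>L\<^sub>\<tau>\<close>, an element of \<open>Pic(X)\<close> is represented by
  its multiplier \<open>\<tau> \<noteq> 0\<close>; tensor product and dual become product and inverse of multipliers.
  Values of functions at the origin never matter.
\<close>

definition generic_hopf :: "complex \<Rightarrow> complex \<Rightarrow> bool" where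
  "generic_hopf a b \<longleftrightarrow> 0 < cmod a \<and> cmod a \<le> cmod b \<and> cmod b < 1 \<and>
     (\<forall>k1 k2 :: nat. 0 < k1 \<longrightarrow> 0 < k2 \<longrightarrow> a ^ k1 \<noteq> b ^ k2)"

definition hopf_map :: "complex \<Rightarrow> complex \<Rightarrow> complex \<times> complex \<Rightarrow> complex \<times> complex" where
  "hopf_map a b = (\<lambda>(x, y). (a * x, b * y))"

text \<open>Holomorphy in two variables: the real derivative exists and is \<open>\<complex>\<close>-linear.\<close>

definition hol2_on :: "(complex \<times> complex \<Rightarrow> complex) \<Rightarrow> (complex \<times> complex) set \<Rightarrow> bool" where
  "hol2_on f U \<longleftrightarrow>
     (\<forall>z\<in>U. \<exists>A B. (f has_derivative (\<lambda>(u, v). A * u + B * v)) (at z))"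

definition H0 :: "complex \<Rightarrow> complex \<Rightarrow> complex \<Rightarrow> (complex \<times> complex \<Rightarrow> complex) set" where
  "H0 a b \<tau> = {s. hol2_on s (- {0}) \<and> (\<forall>z. z \<noteq> 0 \<longrightarrow> s (hopf_map a b z) = \<tau> * s z)}"

definition hopf_deg :: "complex \<Rightarrow> complex \<Rightarrow> real" where
  "hopf_deg b \<tau> = ln (cmod \<tau>) / ln (cmod b)"

abbreviation vec2 :: "complex \<Rightarrow> complex \<Rightarrow> complex^2" where
  "vec2 f g \<equiv> vector [f, g]"

abbreviation mat2 :: "complex \<Rightarrow> complex \<Rightarrow> complex \<Rightarrow> complex \<Rightarrow> complex^2^2" where
  "mat2 p q w r \<equiv> vector [vector [p, q], vector [w, r]]"

text \<open>Multipliers of the two summands of \<open>\<O> \<oplus> L\<^sub>h\<close>.\<close>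

definition summand :: "complex \<Rightarrow> 2 \<Rightarrow> complex" where
  "summand h i = (if i = 1 then 1 else h)"

text \<open>Bundle maps \<open>\<O> \<oplus> L\<^sub>h \<rightarrow> (\<O> \<oplus> L\<^sub>h) \<otimes> L\<^sub>\<kappa>\<close>: the entry \<open>(i, j)\<close> maps summand \<open>j\<close> to summand \<open>i\<close>.\<close>

definition twisted_end ::
  "complex \<Rightarrow> complex \<Rightarrow> complex \<Rightarrow> complex \<Rightarrow> (complex \<times> complex \<Rightarrow> complex^2^2) \<Rightarrow> bool" where
  "twisted_end a b \<kappa> h \<Psi> \<longleftrightarrow>
     (\<forall>i j. (\<lambda>z. \<Psi> z $ i $ j) \<in> H0 a b (\<kappa> * summand h i / summand h j))"

definition higgs_field ::
  "complex \<Rightarrow> complex \<Rightarrow> complex \<Rightarrow> complex \<Rightarrow> (complex \<times> complex \<Rightarrow> complex^2^2) \<Rightarrow> bool" where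
  "higgs_field a b \<kappa> h \<phi> \<longleftrightarrow> twisted_end a b \<kappa> h \<phi> \<and> (\<forall>z. z \<noteq> 0 \<longrightarrow> trace (\<phi> z) = 0)"

definition nowhere_vanishing :: "(complex \<times> complex \<Rightarrow> 'v::zero) \<Rightarrow> bool" where
  "nowhere_vanishing s \<longleftrightarrow> (\<forall>z. z \<noteq> 0 \<longrightarrow> s z \<noteq> 0)"

text \<open>A pair \<open>(h, \<phi>)\<close> stands for the Higgs bundle \<open>(\<O> \<oplus> L\<^sub>h, \<phi>)\<close>.\<close>

definition nv_higgs_bundle ::
  "complex \<Rightarrow> complex \<Rightarrow> complex \<Rightarrow> complex \<times> (complex \<times> complex \<Rightarrow> complex^2^2) \<Rightarrow> bool" where
  "nv_higgs_bundle a b \<kappa> = (\<lambda>(h, \<phi>).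
     h \<noteq> 0 \<and> hopf_deg b h \<le> 0 \<and> higgs_field a b \<kappa> h \<phi> \<and> nowhere_vanishing \<phi>)"

definition automorphism ::
  "complex \<Rightarrow> complex \<Rightarrow> complex \<Rightarrow> (complex \<times> complex \<Rightarrow> complex^2^2) \<Rightarrow> bool" where
  "automorphism a b h \<Psi> \<longleftrightarrow> twisted_end a b 1 h \<Psi> \<and> (\<forall>z. z \<noteq> 0 \<longrightarrow> invertible (\<Psi> z))"

definition conjugate ::
  "complex \<Rightarrow> complex \<Rightarrow> complex \<Rightarrow> (complex \<times> complex \<Rightarrow> complex^2^2) \<Rightarrow>
     (complex \<times> complex \<Rightarrow> complex^2^2) \<Rightarrow> bool" where
  "conjugate a b h \<phi> \<phi>' \<longleftrightarrow>
     (\<exists>\<Psi>. automorphism a b h \<Psi> \<and>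
       (\<forall>z. z \<noteq> 0 \<longrightarrow> \<phi>' z = \<Psi> z ** \<phi> z ** matrix_inv (\<Psi> z)))"

text \<open>
  Tensoring \<open>\<O> \<oplus> H\<close> with \<open>H\<^sup>-\<^sup>1\<close> gives \<open>H\<^sup>-\<^sup>1 \<oplus> \<O>\<close> with the same matrix; reordering the summands to
  \<open>\<O> \<oplus> H\<^sup>-\<^sup>1\<close> exchanges both the rows and the columns.
\<close>

definition renormalize ::
  "(complex \<times> complex \<Rightarrow> complex^2^2) \<Rightarrow> complex \<times> complex \<Rightarrow> complex^2^2" where
  "renormalize \<phi> = (\<lambda>z. mat2 (\<phi> z $ 2 $ 2) (\<phi> z $ 2 $ 1) (\<phi> z $ 1 $ 2) (\<phi> z $ 1 $ 1))"

text \<open>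
  Conjugation by an automorphism, where for \<open>deg H = 0\<close> the two normalizations \<open>\<O> \<oplus> H\<close> and
  \<open>\<O> \<oplus> H\<^sup>-\<^sup>1\<close> are identified.
\<close>

definition higgs_equiv ::
  "complex \<Rightarrow> complex \<Rightarrow> complex \<times> (complex \<times> complex \<Rightarrow> complex^2^2) \<Rightarrow>
     complex \<times> (complex \<times> complex \<Rightarrow> complex^2^2) \<Rightarrow> bool" where
  "higgs_equiv a b = (\<lambda>(h, \<phi>) (h', \<phi>').
     h' = h \<and> conjugate a b h \<phi> \<phi>' \<or>
     hopf_deg b h = 0 \<and> h' = inverse h \<and> conjugate a b h' (renormalize \<phi>) \<phi>')"

text \<open>\<open>S\<close> is an irredundant list of all nowhere-vanishing \<open>L\<^sub>\<kappa>\<close>-twisted Higgs bundles.\<close>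

definition nv_higgs_classified_by ::
  "complex \<Rightarrow> complex \<Rightarrow> complex \<Rightarrow> (complex \<times> (complex \<times> complex \<Rightarrow> complex^2^2)) set \<Rightarrow> bool" where
  "nv_higgs_classified_by a b \<kappa> S \<longleftrightarrow>
     (\<forall>E\<in>S. nv_higgs_bundle a b \<kappa> E) \<and>
     (\<forall>E. nv_higgs_bundle a b \<kappa> E \<longrightarrow> (\<exists>!E'. E' \<in> S \<and> higgs_equiv a b E E'))"

text \<open>
  Let \<open>\<iota>\<close> be a map of a line bundle into a rank-2 bundle. The germ at \<open>z\<close> of a local section \<open>\<sigma>\<close> of
  the (possibly twisted) rank-2 bundle lies in the image sheaf of \<open>\<iota>\<close> iff it is a holomorphic
  multiple of \<open>\<iota>\<close>.
\<close>

definition germ_in_image ::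
  "(complex \<times> complex \<Rightarrow> complex^2) \<Rightarrow> (complex \<times> complex \<Rightarrow> complex^2) \<Rightarrow>
     complex \<times> complex \<Rightarrow> bool" where
  "germ_in_image \<iota> \<sigma> z \<longleftrightarrow>
     (\<exists>V e. open V \<and> z \<in> V \<and> hol2_on e V \<and> (\<forall>v\<in>V. \<sigma> v = e v *s \<iota> v))"

text \<open>Every stalk of the cokernel of \<open>\<iota>\<close> is torsion-free.\<close>

definition torsion_free_quotient :: "(complex \<times> complex \<Rightarrow> complex^2) \<Rightarrow> bool" where
  "torsion_free_quotient \<iota> \<longleftrightarrow>
     (\<forall>z U \<sigma> r. z \<noteq> 0 \<longrightarrow> open U \<longrightarrow> z \<in> U \<longrightarrow>
        (\<forall>i. hol2_on (\<lambda>v. \<sigma> v $ i) U) \<longrightarrow> hol2_on r U \<longrightarrow>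
        \<not> (\<forall>\<^sub>F v in nhds z. r v = 0) \<longrightarrow>
        germ_in_image \<iota> (\<lambda>v. r v *s \<sigma> v) z \<longrightarrow> germ_in_image \<iota> \<sigma> z)"

text \<open>
  A pair \<open>(m, \<iota>)\<close> stands for the map \<open>\<iota>\<close> from \<open>L\<^sub>m\<close> to \<open>\<O> \<oplus> L\<^sub>h\<close>; such a map is an injection of sheaves
  as soon as it is not identically zero.
\<close>

definition sub_line_bundle ::
  "complex \<Rightarrow> complex \<Rightarrow> complex \<Rightarrow> complex \<times> (complex \<times> complex \<Rightarrow> complex^2) \<Rightarrow> bool" where
  "sub_line_bundle a b h = (\<lambda>(m, \<iota>).
     m \<noteq> 0 \<and> (\<forall>i. (\<lambda>z. \<iota> z $ i) \<in> H0 a b (inverse m * summand h i)) \<and>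
     (\<exists>z. z \<noteq> 0 \<and> \<iota> z \<noteq> 0) \<and> torsion_free_quotient \<iota>)"

definition invariant_sub ::
  "(complex \<times> complex \<Rightarrow> complex^2^2) \<Rightarrow> (complex \<times> complex \<Rightarrow> complex^2) \<Rightarrow> bool" where
  "invariant_sub \<phi> \<iota> \<longleftrightarrow> (\<forall>z. z \<noteq> 0 \<longrightarrow> germ_in_image \<iota> (\<lambda>v. \<phi> v *v \<iota> v) z)"

text \<open>
  Two inclusions define the same sub-line bundle iff they differ by an isomorphism
  \<open>u : L\<^sub>m \<rightarrow> L\<^sub>m\<^sub>'\<close>, that is, by a nowhere-vanishing section of \<open>L\<^sub>m\<^sup>-\<^sup>1 \<otimes> L\<^sub>m\<^sub>'\<close>.
\<close>

definition same_sub ::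
  "complex \<Rightarrow> complex \<Rightarrow> complex \<times> (complex \<times> complex \<Rightarrow> complex^2) \<Rightarrow>
     complex \<times> (complex \<times> complex \<Rightarrow> complex^2) \<Rightarrow> bool" where
  "same_sub a b = (\<lambda>(m, \<iota>) (m', \<iota>').
     \<exists>u \<in> H0 a b (inverse m * m'). nowhere_vanishing u \<and>
       (\<forall>z. z \<noteq> 0 \<longrightarrow> \<iota> z = u z *s \<iota>' z))"

definition invariant_subs_are ::
  "complex \<Rightarrow> complex \<Rightarrow> complex \<times> (complex \<times> complex \<Rightarrow> complex^2^2) \<Rightarrow>
     (complex \<times> (complex \<times> complex \<Rightarrow> complex^2)) set \<Rightarrow> bool" where
  "invariant_subs_are a b = (\<lambda>(h, \<phi>) S.
     \<forall>M. sub_line_bundle a b h M \<and> invariant_sub \<phi> (snd M) \<longleftrightarrow> (\<exists>M'\<in>S. same_sub a b M M'))"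

end

theory Submission
  imports Defs "HOL-Complex_Analysis.Conformal_Mappings"
begin

text \<open>
  A section of \<open>L\<^sub>\<tau>\<close> has a Taylor coefficient in \<open>x\<close> given by a Cauchy integral over \<open>\<bar>x\<bar> = 1\<close>, which is an
  entire function of \<open>y\<close>; equivariance then kills every coefficient of \<open>x\<^sup>i y\<^sup>j\<close> except for \<open>\<tau> = a\<^sup>i b\<^sup>j\<close>.
  Genericity makes the numbers \<open>a\<^sup>i b\<^sup>j\<close> distinct, so \<open>H\<^sup>0(X, L\<^sub>\<tau>)\<close> is spanned by at most one monomial.
  The classification becomes a comparison of exponents: a field with \<open>p = s x\<close> can only be
  nonzero on the axis \<open>x = 0\<close> if \<open>q\<close> or \<open>w\<close> is a multiple of a pure power of \<open>y\<close>, which determines \<open>H\<close>.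
  A sub-line bundle is an inclusion by two monomials without common zero, and invariance is the
  vanishing of a quadratic form in them that always splits into two factors.
\<close>

section \<open>Holomorphic functions of two variables\<close>

text \<open>A section is given only off the origin, so on the line y = 0 it lives on a punctured
  plane and no Taylor expansion in x is at hand there. The circle |x| = 1 misses the origin for
  every y, including y = 0; hence coefficients defined by integrals over it, and hence the recovery
  of the axis y = 0 by continuity. The condition deg H <= 0 compares |a| with powers of |b|, and
  genericity does not forbid |a| = |b|^k. In that case the multiplier a / b^k and its inverse both
  have degree 0 and are exchanged by renormalization, which also reverses the sign of s. Only one of
  the two triangular families may then be listed, which explains the weak inequality in one and the
  strict inequality in the other. The determinant of the field separates the parameters t, but it
  sees s only through s^2. The sign of s is recovered from the absence of nonzero sections of H,
  which makes every automorphism upper triangular.\<close>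

lemma contour_integral_parameter_holomorphic:
  assumes cont: "continuous_on (path_image g \<times> U) (\<lambda>(w, y). f w y)"
    and g: "valid_path g" and gd: "continuous_on {0..1} (\<lambda>t. vector_derivative g (at t))"
    and U: "open U" and hol: "\<And>w. w \<in> path_image g \<Longrightarrow> f w holomorphic_on U"
  shows "(\<lambda>y. contour_integral g (\<lambda>w. f w y)) holomorphic_on U"
proof -
  have gcont: "continuous_on {0..1} g"
    using g valid_path_imp_path path_def by blast
  have lin: "continuous_on {0..1} (\<lambda>t. vector_derivative (linepath p q) (at t))" for p q :: complex
    by simp
  have cont_y: "continuous_on U (\<lambda>y. contour_integral g (\<lambda>w. f w y))"
  proof -
    have "continuous_on (U \<times> cbox 0 (1::real)) ((\<lambda>(w, y). f w y) \<circ> (\<lambda>x. (g (snd x), fst x)))"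
      by (rule continuous_on_compose)
        (auto simp: path_image_def intro!: continuous_intros continuous_on_subset[OF cont]
           continuous_on_compose2[OF gcont])
    then have "continuous_on (U \<times> cbox 0 (1::real))
        (\<lambda>(y, t). f (g t) y * vector_derivative g (at t))"
      by (auto simp: case_prod_unfold o_def intro!: continuous_intros continuous_on_compose2[OF gd])
    from integral_continuous_on_param[OF this] show ?thesis
      by (simp add: contour_integral_integral)
  qed
  \<comment> \<open>Morera: the integral over a triangle is exchanged with the integral along
    \<open>g\<close>, and for each fixed point of \<open>g\<close> the inner triangle integral
    vanishes by Cauchy's theorem.\<close>
  have "(\<lambda>y. contour_integral g (\<lambda>w. f w y)) analytic_on U"
  proof (rule Morera_triangle[OF cont_y U], intro impI)
    fix p q r :: complex
    assume tri: "convex hull {p, q, r} \<subseteq> U"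
    have seg: "closed_segment p q \<subseteq> U" "closed_segment q r \<subseteq> U" "closed_segment r p \<subseteq> U"
      using tri hull_mono[of "{p, q}" "{p, q, r}" convex] hull_mono[of "{q, r}" "{p, q, r}" convex]
        hull_mono[of "{r, p}" "{p, q, r}" convex]
      by (auto simp: segment_convex_hull)
    have swap: "contour_integral (linepath p' q') (\<lambda>y. contour_integral g (\<lambda>w. f w y)) =
        contour_integral g (\<lambda>w. contour_integral (linepath p' q') (f w))"
      if "closed_segment p' q' \<subseteq> U" for p' q'
      by (rule contour_integral_swap[symmetric, OF _ g _ gd lin])
        (use that in \<open>auto intro!: continuous_on_subset[OF cont]\<close>)
    have int: "(\<lambda>w. contour_integral (linepath p' q') (f w)) contour_integrable_on g"
      if "closed_segment p' q' \<subseteq> U" for p' q'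
    proof -
      have lp: "continuous_on (path_image g \<times> {0..1}) (\<lambda>x. linepath p' q' (snd x))"
        unfolding linepath_def by (intro continuous_intros)
      have "continuous_on (path_image g \<times> cbox 0 (1::real))
          ((\<lambda>(w, y). f w y) \<circ> (\<lambda>x. (fst x, linepath p' q' (snd x))))"
        by (rule continuous_on_compose)
          (use that in \<open>auto simp: linepath_in_path intro!: lp continuous_intros continuous_on_subset[OF cont]\<close>)
      then have "continuous_on (path_image g \<times> cbox 0 (1::real))
          (\<lambda>(w, t). f w (linepath p' q' t) * vector_derivative (linepath p' q') (at t))"
        by (auto simp: case_prod_unfold o_def intro!: continuous_intros)
      from integral_continuous_on_param[OF this]
      have "continuous_on (path_image g) (\<lambda>w. contour_integral (linepath p' q') (f w))"
        by (simp add: contour_integral_integral)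
      then have "continuous_on {0..1} (\<lambda>t. contour_integral (linepath p' q') (f (g t)))"
        by (rule continuous_on_compose2[OF _ gcont]) (auto simp: path_image_def)
      then show ?thesis
        unfolding contour_integrable_on
        by (intro integrable_continuous_interval continuous_intros gd)
    qed
    have zero: "contour_integral (linepath p q) (f w) + contour_integral (linepath q r) (f w) +
        contour_integral (linepath r p) (f w) = 0" if "w \<in> path_image g" for w
    proof -
      have h: "f w holomorphic_on convex hull {p, q, r}"
        using hol[OF that] tri holomorphic_on_subset by blast
      have c: "(f w) contour_integrable_on linepath p' q'" if "closed_segment p' q' \<subseteq> U" for p' q'
        using hol[OF \<open>w \<in> path_image g\<close>] that
        by (meson contour_integrable_continuous_linepath holomorphic_on_imp_continuous_on
            continuous_on_subset)
      have "(f w has_contour_integral 0) (linepath p q +++ linepath q r +++ linepath r p)"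
        using Cauchy_theorem_triangle[OF h] .
      then have "contour_integral (linepath p q +++ linepath q r +++ linepath r p) (f w) = 0"
        by (rule contour_integral_unique)
      then show ?thesis using c[OF seg(1)] c[OF seg(2)] c[OF seg(3)]
        by (simp add: add.assoc)
    qed
    have "contour_integral g (\<lambda>w. contour_integral (linepath p q) (f w)) +
        contour_integral g (\<lambda>w. contour_integral (linepath q r) (f w)) +
        contour_integral g (\<lambda>w. contour_integral (linepath r p) (f w)) =
        contour_integral g (\<lambda>w. contour_integral (linepath p q) (f w) +
          contour_integral (linepath q r) (f w) + contour_integral (linepath r p) (f w))"
      using int[OF seg(1)] int[OF seg(2)] int[OF seg(3)]
      by (simp add: contour_integral_add contour_integrable_add)
    also have "\<dots> = contour_integral g (\<lambda>w. 0)"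
      by (rule contour_integral_eq) (simp add: zero)
    finally show "contour_integral (linepath p q) (\<lambda>y. contour_integral g (\<lambda>w. f w y)) +
        contour_integral (linepath q r) (\<lambda>y. contour_integral g (\<lambda>w. f w y)) +
        contour_integral (linepath r p) (\<lambda>y. contour_integral g (\<lambda>w. f w y)) = 0"
      using swap seg by simp
  qed
  then show ?thesis by (rule analytic_imp_holomorphic)
qed

lemma hol2_on_imp_continuous_on: "hol2_on f U \<Longrightarrow> continuous_on U f"
  unfolding hol2_on_def
  by (metis continuous_at_imp_continuous_on has_derivative_continuous)

lemma hol2_on_subset: "hol2_on f U \<Longrightarrow> V \<subseteq> U \<Longrightarrow> hol2_on f V"
  unfolding hol2_on_def by blast

text \<open>By the chain rule along an affine complex line, complex linearity of the derivative
  becomes complex differentiability in \<open>t\<close>. All one-variable theory enters through such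
  restrictions.\<close>

lemma hol2_on_line:
  assumes f: "hol2_on f U" and S: "\<And>t. t \<in> S \<Longrightarrow> (p + t * u, q + t * v) \<in> U"
  shows "(\<lambda>t. f (p + t * u, q + t * v)) holomorphic_on S"
proof (rule holomorphic_onI)
  fix t assume "t \<in> S"
  then obtain A B where
    d: "(f has_derivative (\<lambda>(x, y). A * x + B * y)) (at (p + t * u, q + t * v))"
    using f S unfolding hol2_on_def by blast
  have "((\<lambda>t. (p + t * u, q + t * v)) has_derivative (\<lambda>h. (h * u, h * v))) (at t within S)"
    by (auto intro!: derivative_eq_intros)
  from has_derivative_compose[OF this d]
  have "((\<lambda>t. f (p + t * u, q + t * v)) has_derivative (\<lambda>h. A * (h * u) + B * (h * v))) (at t within S)"
    by simp
  moreover have "(\<lambda>h. A * (h * u) + B * (h * v)) = (*) (A * u + B * v)"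
    by (auto simp: algebra_simps)
  ultimately have "((\<lambda>t. f (p + t * u, q + t * v)) has_field_derivative (A * u + B * v)) (at t within S)"
    by (simp add: has_field_derivative_def)
  then show "(\<lambda>t. f (p + t * u, q + t * v)) field_differentiable at t within S"
    using field_differentiable_def by blast
qed

lemma hol2_on_cong:
  assumes "open U" "\<And>z. z \<in> U \<Longrightarrow> f z = g z"
  shows "hol2_on f U \<longleftrightarrow> hol2_on g U"
proof -
  have "hol2_on g U" if f: "hol2_on f U" and eq: "\<And>z. z \<in> U \<Longrightarrow> f z = g z" for f g
    unfolding hol2_on_def
  proof
    fix z assume z: "z \<in> U"
    then obtain A B where "(f has_derivative (\<lambda>(u, v). A * u + B * v)) (at z)"
      using f unfolding hol2_on_def by blast
    then have "(g has_derivative (\<lambda>(u, v). A * u + B * v)) (at z)"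
      by (rule has_derivative_transform_within_open[OF _ assms(1) z eq])
    then show "\<exists>A B. (g has_derivative (\<lambda>(u, v). A * u + B * v)) (at z)" by blast
  qed
  from this[of f g] this[of g f] show ?thesis using assms(2) by metis
qed

lemma hol2_on_const: "hol2_on (\<lambda>z. c) U"
  unfolding hol2_on_def by (intro ballI exI[of _ 0]) (simp add: case_prod_unfold)

lemma hol2_on_fst: "hol2_on fst U"
  unfolding hol2_on_def
  by (intro ballI exI[of _ 1] exI[of _ 0])
    (auto simp: case_prod_unfold intro!: derivative_eq_intros)

lemma hol2_on_snd: "hol2_on snd U"
  unfolding hol2_on_def
  by (intro ballI exI[of _ 0] exI[of _ 1])
    (auto simp: case_prod_unfold intro!: derivative_eq_intros)

lemma hol2_on_mult:
  assumes "hol2_on f U" "hol2_on g U"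
  shows "hol2_on (\<lambda>z. f z * g z) U"
  unfolding hol2_on_def
proof
  fix z assume "z \<in> U"
  then obtain A B A' B' where
    "(f has_derivative (\<lambda>(u, v). A * u + B * v)) (at z)"
    "(g has_derivative (\<lambda>(u, v). A' * u + B' * v)) (at z)"
    using assms unfolding hol2_on_def by blast
  from has_derivative_mult[OF this]
  have "((\<lambda>z. f z * g z) has_derivative
      (\<lambda>(u, v). (f z * A' + A * g z) * u + (f z * B' + B * g z) * v)) (at z)"
    by (rule has_derivative_eq_rhs) (auto simp: algebra_simps)
  then show "\<exists>A B. ((\<lambda>z. f z * g z) has_derivative (\<lambda>(u, v). A * u + B * v)) (at z)"
    by blast
qed

lemma hol2_on_diff:
  assumes "hol2_on f U" "hol2_on g U"
  shows "hol2_on (\<lambda>z. f z - g z) U"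
  unfolding hol2_on_def
proof
  fix z assume "z \<in> U"
  then obtain A B A' B' where
    "(f has_derivative (\<lambda>(u, v). A * u + B * v)) (at z)"
    "(g has_derivative (\<lambda>(u, v). A' * u + B' * v)) (at z)"
    using assms unfolding hol2_on_def by blast
  from has_derivative_diff[OF this]
  have "((\<lambda>z. f z - g z) has_derivative (\<lambda>(u, v). (A - A') * u + (B - B') * v)) (at z)"
    by (rule has_derivative_eq_rhs) (auto simp: algebra_simps)
  then show "\<exists>A B. ((\<lambda>z. f z - g z) has_derivative (\<lambda>(u, v). A * u + B * v)) (at z)"
    by blast
qed

lemma hol2_on_inverse:
  assumes "hol2_on f U" "\<And>z. z \<in> U \<Longrightarrow> f z \<noteq> 0"
  shows "hol2_on (\<lambda>z. inverse (f z)) U"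
  unfolding hol2_on_def
proof
  fix z assume z: "z \<in> U"
  then obtain A B where "(f has_derivative (\<lambda>(u, v). A * u + B * v)) (at z)"
    using assms unfolding hol2_on_def by blast
  from Deriv.has_derivative_inverse[where f = f, OF assms(2)[OF z] this]
  have "((\<lambda>z. inverse (f z)) has_derivative
      (\<lambda>(u, v). (- (inverse (f z) * A * inverse (f z))) * u
        + (- (inverse (f z) * B * inverse (f z))) * v)) (at z)"
    by (rule has_derivative_eq_rhs) (auto simp: algebra_simps)
  then show "\<exists>A B. ((\<lambda>z. inverse (f z)) has_derivative (\<lambda>(u, v). A * u + B * v)) (at z)"
    by blast
qed

lemma hol2_on_power: "hol2_on f U \<Longrightarrow> hol2_on (\<lambda>z. f z ^ n) U"
  by (induction n) (auto intro: hol2_on_const hol2_on_mult)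

text \<open>Germs of holomorphic functions have no zero divisors. Near some point \<open>v0\<close>
  of a ball around \<open>z\<close> the factor \<open>r\<close> has no zeros, so \<open>h\<close>
  vanishes on an open set there; every other point of the ball is joined to \<open>v0\<close> by a
  complex line, on which the one-variable identity theorem applies.\<close>

lemma hol2_mult_eq_0:
  assumes r: "hol2_on r U" and h: "hol2_on h U" and U: "open U" "z \<in> U"
    and r0: "\<not> (\<forall>\<^sub>F v in nhds z. r v = 0)" and rh: "\<And>v. v \<in> U \<Longrightarrow> r v * h v = 0"
  shows "\<forall>\<^sub>F v in nhds z. h v = 0"
proof -
  obtain e where e: "e > 0" "ball z e \<subseteq> U"
    using U open_contains_ball by blast
  obtain v0 where v0: "v0 \<in> ball z e" "r v0 \<noteq> 0"
    using r0 e(1) unfolding eventually_nhds by (meson centre_in_ball open_ball)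
  define N where "N = {v \<in> U. r v \<in> - {0}}"
  have N: "open N" "v0 \<in> N" "\<And>v. v \<in> N \<Longrightarrow> h v = 0"
    using v0 e(2) rh continuous_open_preimage[OF hol2_on_imp_continuous_on[OF r] U(1), of "- {0}"]
    by (auto simp: N_def vimage_def Int_def)
  have "h w = 0" if w: "w \<in> ball z e" for w
  proof -
    define p q u v where "p = fst v0" "q = snd v0" "u = fst w - p" "v = snd w - q"
    \<comment> \<open>The line runs from \<open>v0\<close> at parameter 0 to \<open>w\<close> at
      parameter 1. As \<open>l\<close> is real-affine and the ball is convex, the parameter set
      \<open>T\<close> is convex, hence connected.\<close>
    define l where "l t = (p + t * u, q + t * v)" for t :: complex
    have l01: "l 0 = v0" "l 1 = w"
      by (simp_all add: l_def p_q_u_v_def)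
    have lcont: "continuous_on UNIV l"
      unfolding l_def by (intro continuous_intros)
    define T where "T = l -` ball z e"
    have "open T" "open (l -` (N \<inter> ball z e))"
      using lcont N(1) by (auto simp: T_def intro!: open_vimage)
    have "convex T"
    proof (rule convexI)
      fix s t x y assume *: "s \<in> T" "t \<in> T" "0 \<le> x" "0 \<le> y" "x + y = (1::real)"
      have 1: "complex_of_real x + complex_of_real y = 1"
        using *(5) by (metis of_real_1 of_real_add)
      have "l (x *\<^sub>R s + y *\<^sub>R t) = x *\<^sub>R l s + y *\<^sub>R l t"
      proof -
        have "c + (x *\<^sub>R s + y *\<^sub>R t) * d = x *\<^sub>R (c + s * d) + y *\<^sub>R (c + t * d)" for c d
        proof -
          have "x *\<^sub>R (c + s * d) + y *\<^sub>R (c + t * d) =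
              (complex_of_real x + complex_of_real y) * c + (x *\<^sub>R s + y *\<^sub>R t) * d"
            by (simp add: scaleR_conv_of_real algebra_simps)
          then show ?thesis by (simp add: 1)
        qed
        then show ?thesis by (simp add: l_def)
      qed
      then show "x *\<^sub>R s + y *\<^sub>R t \<in> T"
        using convexD[OF convex_ball[of z e]] * by (auto simp: T_def)
    qed
    have hl: "(\<lambda>t. h (l t)) holomorphic_on T"
      unfolding l_def by (rule hol2_on_line[OF h]) (use e(2) in \<open>auto simp: T_def l_def\<close>)
    have "h (l 1) = 0"
      by (rule analytic_continuation_open[of "l -` (N \<inter> ball z e)" T "\<lambda>t. h (l t)" "\<lambda>t. 0"])
        (use \<open>open T\<close> \<open>open (l -` _)\<close> \<open>convex T\<close> hl N v0 l01 w in
          \<open>auto simp: T_def intro!: convex_connected exI[of _ 0]\<close>)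
    then show ?thesis by (simp add: l01)
  qed
  then show ?thesis using e(1) unfolding eventually_nhds by (meson centre_in_ball open_ball)
qed

section \<open>Sections of line bundles\<close>

lemma isCont_eq_at_0:
  fixes f g :: "complex \<Rightarrow> complex"
  assumes "isCont f 0" "isCont g 0" "\<And>y. y \<noteq> 0 \<Longrightarrow> f y = g y"
  shows "f 0 = g 0"
proof -
  have "(f \<longlongrightarrow> f 0) (at 0)" "(g \<longlongrightarrow> g 0) (at 0)"
    using assms(1,2) by (auto simp: isCont_def)
  moreover have "(f \<longlongrightarrow> g 0) (at 0)"
    using \<open>(g \<longlongrightarrow> g 0) (at 0)\<close>
    by (rule Lim_transform_eventually) (auto simp: eventually_at_filter assms(3))
  ultimately show ?thesis using tendsto_unique by (metis at_neq_bot)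
qed

text \<open>After cancelling, a coincidence reads either \<open>a ^ k1 * b ^ k2 = 1\<close> with
  \<open>k1\<close> positive, impossible because both moduli are below 1, or
  \<open>a ^ k1 = b ^ k2\<close> with positive exponents, which is what genericity rules out. Once
  the exponents of \<open>a\<close> agree, those of \<open>b\<close> agree by comparing
  moduli.\<close>

lemma monomial_inj:
  fixes a b :: complex
  assumes "0 < cmod a" "cmod a < 1" "0 < cmod b" "cmod b < 1"
    and gen: "\<And>k1 k2 :: nat. 0 < k1 \<Longrightarrow> 0 < k2 \<Longrightarrow> a ^ k1 \<noteq> b ^ k2"
    and eq: "a ^ i * b ^ j = a ^ i' * b ^ j'"
  shows "i = i' \<and> j = j'"
proof -
  have no: False if "i < i'" "a ^ i * b ^ j = a ^ i' * b ^ j'" for i i' j j'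
  proof -
    have "a ^ i' = a ^ i * a ^ (i' - i)" using that by (simp flip: power_add)
    then have e: "b ^ j = a ^ (i' - i) * b ^ j'" using that(2) assms by simp
    show False
    proof (cases "j \<le> j'")
      case True
      then have "b ^ j' = b ^ j * b ^ (j' - j)" by (simp flip: power_add)
      then have "a ^ (i' - i) * b ^ (j' - j) = 1" using e assms by simp
      then have n: "cmod a ^ (i' - i) * cmod b ^ (j' - j) = 1"
        by (metis norm_mult norm_one norm_power)
      have "cmod a ^ (i' - i) < 1" using that assms by (simp add: power_Suc_less_one power_less_one_iff)
      moreover have "cmod b ^ (j' - j) \<le> 1" using assms by (simp add: power_le_one)
      ultimately have "cmod a ^ (i' - i) * cmod b ^ (j' - j) < 1"
        using assms by (smt (verit) mult_left_le mult_less_cancel_left zero_less_power)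
      then show False using n by simp
    next
      case False
      then have "b ^ j = b ^ j' * b ^ (j - j')" by (simp flip: power_add)
      then have "b ^ (j - j') = a ^ (i' - i)" using e assms by simp
      then show False using gen[of "i' - i" "j - j'"] that False by simp
    qed
  qed
  have "i = i'" using no[of i i' j j'] no[of i' i j' j] eq by (metis linorder_neqE_nat)
  moreover have "j = j'"
  proof -
    have "cmod b ^ j = cmod b ^ j'" using eq assms \<open>i = i'\<close> by (metis mult_cancel_left norm_power power_not_zero norm_zero less_irrefl)
    then show ?thesis using assms
      by (metis linorder_neqE_nat power_strict_decreasing_iff less_irrefl)
  qed
  ultimately show ?thesis by simp
qed

lemma sums_single_coeff:
  fixes c :: "nat \<Rightarrow> complex"
  assumes "(\<lambda>n. c n * x ^ n) sums s" "\<And>n. n \<noteq> m \<Longrightarrow> c n = 0"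
  shows "s = c m * x ^ m"
proof -
  have "(\<lambda>n. c n * x ^ n) = (\<lambda>n. if n = m then c n * x ^ n else 0)"
    using assms(2) by auto
  then show ?thesis using assms(1) sums_single[of m "\<lambda>n. c n * x ^ n"] sums_unique2 by metis
qed

text \<open>The alternative \<open>c = 0\<close> accounts for the zero section, which exists for
  every \<tau>; its exponents are then arbitrary.\<close>

theorem H0_iff:
  assumes gen: "generic_hopf a b"
  shows "s \<in> H0 a b \<tau> \<longleftrightarrow>
    (\<exists>c i j. (c = 0 \<or> \<tau> = a ^ i * b ^ j) \<and> (\<forall>z. z \<noteq> 0 \<longrightarrow> s z = c * fst z ^ i * snd z ^ j))"
    (is "_ \<longleftrightarrow> ?R")
proof
  have ab: "0 < cmod a" "cmod a < 1" "0 < cmod b" "cmod b < 1" "a \<noteq> 0" "b \<noteq> 0"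
    using gen unfolding generic_hopf_def by auto
  show "s \<in> H0 a b \<tau>" if R: ?R
  proof -
    obtain c i j where c: "c = 0 \<or> \<tau> = a ^ i * b ^ j"
      and s: "\<And>z. z \<noteq> 0 \<Longrightarrow> s z = c * fst z ^ i * snd z ^ j"
      using R by blast
    have "hol2_on (\<lambda>z. c * fst z ^ i * snd z ^ j) (- {0})"
      by (intro hol2_on_mult hol2_on_power hol2_on_const hol2_on_fst hol2_on_snd)
    then have "hol2_on s (- {0})"
      using s by (subst hol2_on_cong[where g = "\<lambda>z. c * fst z ^ i * snd z ^ j"]) auto
    moreover have "s (hopf_map a b z) = \<tau> * s z" if "z \<noteq> 0" for z
    proof -
      have "hopf_map a b z \<noteq> 0"
        using that ab by (cases z) (auto simp: hopf_map_def zero_prod_def)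
      then show ?thesis using c s that
        by (cases z) (auto simp: hopf_map_def power_mult_distrib)
    qed
    ultimately show ?thesis unfolding H0_def by blast
  qed
  assume "s \<in> H0 a b \<tau>"
  then have hol: "hol2_on s (- {0})"
    and equi: "\<And>z. z \<noteq> 0 \<Longrightarrow> s (hopf_map a b z) = \<tau> * s z"
    unfolding H0_def by auto
  \<comment> \<open>These are the coordinate lines that avoid the origin, so the restrictions are
    entire.\<close>
  have hx: "(\<lambda>x. s (x, y)) holomorphic_on UNIV" if "y \<noteq> 0" for y
    using hol2_on_line[OF hol, of UNIV 0 1 y 0] that by (simp add: zero_prod_def)
  have hy: "(\<lambda>y. s (x, y)) holomorphic_on UNIV" if "x \<noteq> 0" for x
    using hol2_on_line[OF hol, of UNIV x 0 0 1] that by (simp add: zero_prod_def)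
  define C where "C i y = contour_integral (circlepath 0 1) (\<lambda>w. s (w, y) / w ^ Suc i)" for i y
  define D where "D i j = (deriv ^^ j) (C i) 0 / fact j" for i j
  have holC: "C i holomorphic_on UNIV" for i
    unfolding C_def
  proof (rule contour_integral_parameter_holomorphic)
    have "continuous_on (path_image (circlepath 0 1) \<times> UNIV) s"
      by (rule continuous_on_subset[OF hol2_on_imp_continuous_on[OF hol]])
        (auto simp: zero_prod_def)
    then show "continuous_on (path_image (circlepath 0 1) \<times> UNIV) (\<lambda>(w, y). s (w, y) / w ^ Suc i)"
      by (auto simp: case_prod_unfold intro!: continuous_intros)
    show "continuous_on {0..1} (\<lambda>t. vector_derivative (circlepath 0 1) (at t))"
      by (auto simp: vector_derivative_circlepath intro!: continuous_intros)
    show "(\<lambda>y. s (w, y) / w ^ Suc i) holomorphic_on UNIV" if "w \<in> path_image (circlepath 0 1)" for w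
    proof -
      have "w \<noteq> 0" using that by auto
      then show ?thesis by (intro holomorphic_intros hy) auto
    qed
  qed auto
  have Ccoeff: "C i y = 2 * pi * \<i> * (deriv ^^ i) (\<lambda>x. s (x, y)) 0 / fact i" if "y \<noteq> 0" for i y
    using Cauchy_contour_integral_circlepath[of 0 1 "\<lambda>x. s (x, y)" 0 i] hx[OF that]
    unfolding C_def
    by (simp add: holomorphic_on_imp_continuous_on holomorphic_on_subset continuous_on_subset)
  \<comment> \<open>Precomposing with x |-> a x multiplies the i-th derivative at 0 by
    \<open>a ^ i\<close>; equivariance turns the result into \<tau> times the coefficient at
    \<open>y\<close>.\<close>
  have Cequi': "a ^ i * C i (b * y) = \<tau> * C i y" if "y \<noteq> 0" for i y
  proof -
    have "a ^ i * (deriv ^^ i) (\<lambda>x. s (x, b * y)) 0 = (deriv ^^ i) (\<lambda>x. s (a * x, b * y)) 0"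
      using higher_deriv_compose_linear[OF hx[of "b * y"], of UNIV 0 a i] that ab by simp
    also have "(\<lambda>x. s (a * x, b * y)) = (\<lambda>x. \<tau> * s (x, y))"
      using equi that by (auto simp: hopf_map_def zero_prod_def)
    also have "(deriv ^^ i) (\<lambda>x. \<tau> * s (x, y)) 0 = \<tau> * (deriv ^^ i) (\<lambda>x. s (x, y)) 0"
      by (rule higher_deriv_cmult[OF hx[OF that]]) auto
    finally show ?thesis using that ab by (simp add: Ccoeff field_simps)
  qed
  \<comment> \<open>Both sides are continuous in \<open>y\<close>, so the relation extends to y =
    0.\<close>
  have Cequi: "a ^ i * C i (b * y) = \<tau> * C i y" for i y
  proof (cases "y = 0")
    case True
    have cont: "isCont (C i) 0"
      using holC[of i] holomorphic_on_imp_continuous_on continuous_on_eq_continuous_at by blast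
    have "a ^ i * C i (b * 0) = \<tau> * C i 0"
    proof (rule isCont_eq_at_0)
      have "isCont (\<lambda>y. C i (b * y)) 0"
        by (rule isCont_o2[where g = "C i"]) (auto intro!: continuous_intros cont)
      then show "isCont (\<lambda>y. a ^ i * C i (b * y)) 0" by (intro continuous_intros)
      show "isCont (\<lambda>y. \<tau> * C i y) 0" by (intro continuous_intros cont)
    qed (rule Cequi')
    then show ?thesis using True by simp
  qed (rule Cequi')
  \<comment> \<open>The same scaling argument in \<open>y\<close>, applied to the entire function
    \<open>C i\<close>: a nonzero double coefficient forces \<tau> to be the matching monomial in
    \<open>a\<close> and \<open>b\<close>.\<close>
  have Dequi: "a ^ i * b ^ j * D i j = \<tau> * D i j" for i j
  proof -
    have hb: "(\<lambda>y. C i (b * y)) holomorphic_on UNIV"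
      using holomorphic_on_compose_gen[of "\<lambda>y. b * y" UNIV "C i" UNIV] holC
      by (simp add: o_def holomorphic_intros)
    have "a ^ i * (b ^ j * (deriv ^^ j) (C i) 0) = a ^ i * (deriv ^^ j) (\<lambda>y. C i (b * y)) 0"
      using higher_deriv_compose_linear[OF holC[of i], of UNIV 0 b j] by simp
    also have "\<dots> = (deriv ^^ j) (\<lambda>y. a ^ i * C i (b * y)) 0"
      by (rule higher_deriv_cmult[OF hb, symmetric]) auto
    also have "\<dots> = (deriv ^^ j) (\<lambda>y. \<tau> * C i y) 0"
      by (simp add: Cequi)
    also have "\<dots> = \<tau> * (deriv ^^ j) (C i) 0"
      by (rule higher_deriv_cmult[OF holC]) auto
    finally show ?thesis by (simp add: D_def)
  qed
  have Csums: "(\<lambda>j. D i j * y ^ j) sums C i y" for i y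
    using holomorphic_power_series[of "C i" 0 "cmod y + 1" y] holomorphic_on_subset[OF holC subset_UNIV]
    by (auto simp: D_def)
  have ssums: "(\<lambda>i. (C i y / (2 * pi * \<i>)) * x ^ i) sums s (x, y)" if "y \<noteq> 0" for x y
    using holomorphic_power_series[of "\<lambda>x. s (x, y)" 0 "cmod x + 1" x] that
      holomorphic_on_subset[OF hx[OF that] subset_UNIV]
    by (auto simp: Ccoeff)
  have "\<exists>c i j. (c = 0 \<or> \<tau> = a ^ i * b ^ j) \<and> (\<forall>x y. y \<noteq> 0 \<longrightarrow> s (x, y) = c * x ^ i * y ^ j)"
  proof (cases "\<exists>i j. D i j \<noteq> 0")
    case False
    have C0: "C i y = 0" for i y
      using Csums[of i y] False sums_single_coeff[of "D i" y _ 0] by simp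
    have "s (x, y) = 0" if "y \<noteq> 0" for x y
      using ssums[OF that, of x] sums_single_coeff[of "\<lambda>i. C i y / (2 * pi * \<i>)" x _ 0] by (simp add: C0)
    then show ?thesis by (intro exI[of _ 0]) auto
  next
    case True
    then obtain i j where D: "D i j \<noteq> 0" by blast
    then have \<tau>: "\<tau> = a ^ i * b ^ j" using Dequi[of i j] by simp
    have D0: "D i' j' = 0" if "\<not> (i' = i \<and> j' = j)" for i' j'
    proof (rule ccontr)
      assume "D i' j' \<noteq> 0"
      then have "a ^ i' * b ^ j' = a ^ i * b ^ j" using Dequi[of i' j'] \<tau> by simp
      then have "i' = i \<and> j' = j"
        using monomial_inj[of a b i' j' i j] gen ab unfolding generic_hopf_def by blast
      then show False using that by simp
    qed
    have C0: "C i' y = 0" if "i' \<noteq> i" for i' y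
      using Csums[of i' y] D0 that sums_single_coeff[of "D i'" y _ 0] by simp
    have Ci: "C i y = D i j * y ^ j" for y
      using Csums[of i y] D0 sums_single_coeff[of "D i" y _ j] by simp
    have "s (x, y) = D i j / (2 * pi * \<i>) * x ^ i * y ^ j" if "y \<noteq> 0" for x y
      using ssums[OF that, of x] sums_single_coeff[of "\<lambda>i. C i y / (2 * pi * \<i>)" x _ i]
      by (simp add: C0 Ci mult.assoc mult.commute[of "x ^ i"])
    then show ?thesis using \<tau> by blast
  qed
  then obtain c i j where c: "c = 0 \<or> \<tau> = a ^ i * b ^ j"
    and s: "\<And>x y. y \<noteq> 0 \<Longrightarrow> s (x, y) = c * x ^ i * y ^ j"
    by blast
  \<comment> \<open>The series only covers nonzero y. A point of the axis y = 0 has x nonzero, so it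
    is reached by continuity along the line of constant x.\<close>
  have "s (x, y) = c * x ^ i * y ^ j" if "(x, y) \<noteq> 0" for x y
  proof (cases "y = 0")
    case True
    then have x: "x \<noteq> 0" using that by (auto simp: zero_prod_def)
    have "isCont (\<lambda>y. s (x, y)) 0"
      using hy[OF x] holomorphic_on_imp_continuous_on continuous_on_eq_continuous_at by blast
    then have "s (x, 0) = c * x ^ i * 0 ^ j"
      by (rule isCont_eq_at_0[where g = "\<lambda>y. c * x ^ i * y ^ j"]) (auto simp: s intro!: continuous_intros)
    then show ?thesis using True by simp
  qed (rule s)
  then show ?R using c by (intro exI[of _ c] exI[of _ i] exI[of _ j]) auto
qed

section \<open>Sub-line bundles\<close>

lemma hol2_on_nonzero_nhd:
  assumes "hol2_on f (- {0})" "z \<noteq> 0" "f z \<noteq> 0"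
  obtains N where "open N" "z \<in> N" "N \<subseteq> - {0}" "\<And>v. v \<in> N \<Longrightarrow> f v \<noteq> 0"
proof
  show "open {v \<in> - {0}. f v \<in> - {0}}"
    using continuous_open_preimage[OF hol2_on_imp_continuous_on[OF assms(1)], of "- {0}"]
    by (auto simp: vimage_def Int_def)
qed (use assms in auto)

text \<open>Dividing by a component of \<iota> that is nonzero near \<open>z\<close> gives the only
  candidate multiplier \<open>e'\<close>. The defect of \<sigma> from \<open>e'\<close> times
  \<iota> is killed by \<open>r\<close>, hence vanishes because there are no zero divisors.\<close>

lemma torsion_free_quotient_if_nonzero:
  assumes hol: "\<And>i. hol2_on (\<lambda>v. \<iota> v $ i) (- {0})" and nz: "\<And>z. z \<noteq> 0 \<Longrightarrow> \<iota> z \<noteq> 0"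
  shows "torsion_free_quotient \<iota>"
  unfolding torsion_free_quotient_def
proof (intro allI impI)
  fix z U \<sigma> r
  assume z: "z \<noteq> 0" and U: "open U" "z \<in> U" and \<sigma>: "\<forall>i. hol2_on (\<lambda>v. \<sigma> v $ i) U"
    and r: "hol2_on r U" "\<not> (\<forall>\<^sub>F v in nhds z. r v = 0)"
    and "germ_in_image \<iota> (\<lambda>v. r v *s \<sigma> v) z"
  then obtain V e where V: "open V" "z \<in> V" "hol2_on e V"
    and e: "\<And>v. v \<in> V \<Longrightarrow> r v *s \<sigma> v = e v *s \<iota> v"
    unfolding germ_in_image_def by blast
  obtain k where k: "\<iota> z $ k \<noteq> 0" using nz[OF z] by (auto simp: vec_eq_iff)
  obtain N where N: "open N" "z \<in> N" "N \<subseteq> - {0}" "\<And>v. v \<in> N \<Longrightarrow> \<iota> v $ k \<noteq> 0"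
    using hol2_on_nonzero_nhd[OF hol[of k] z k] by blast
  define W where "W = U \<inter> V \<inter> N"
  have W: "open W" "z \<in> W" "W \<subseteq> U" "W \<subseteq> V" "W \<subseteq> N" "W \<subseteq> - {0}"
    using U V N by (auto simp: W_def)
  define e' where "e' v = \<sigma> v $ k * inverse (\<iota> v $ k)" for v
  have e': "hol2_on e' W"
    unfolding e'_def
    using W \<sigma> hol N by (intro hol2_on_mult hol2_on_inverse) (blast intro: hol2_on_subset)+
  have "\<forall>\<^sub>F v in nhds z. \<sigma> v $ i - e' v * \<iota> v $ i = 0" for i
  proof (rule hol2_mult_eq_0[OF _ _ W(1,2) r(2)])
    show "hol2_on r W" using r W hol2_on_subset by blast
    show "hol2_on (\<lambda>v. \<sigma> v $ i - e' v * \<iota> v $ i) W"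
      using W \<sigma> hol by (intro hol2_on_mult hol2_on_diff e') (blast intro: hol2_on_subset)+
    fix v assume v: "v \<in> W"
    have *: "r v * \<sigma> v $ j = e v * \<iota> v $ j" for j
      using e[of v] v W by (auto simp: vec_eq_iff)
    have "r v * (\<sigma> v $ i - e' v * \<iota> v $ i) =
        r v * \<sigma> v $ i - (r v * \<sigma> v $ k) * inverse (\<iota> v $ k) * \<iota> v $ i"
      by (simp add: e'_def algebra_simps)
    also have "\<dots> = 0" using N(4)[of v] v W by (auto simp: *)
    finally show "r v * (\<sigma> v $ i - e' v * \<iota> v $ i) = 0" .
  qed
  then have "\<forall>\<^sub>F v in nhds z. \<forall>i. \<sigma> v $ i - e' v * \<iota> v $ i = 0"
    by (simp add: eventually_all_finite)
  then obtain S where S: "open S" "z \<in> S" "\<And>v i. v \<in> S \<Longrightarrow> \<sigma> v $ i = e' v * \<iota> v $ i"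
    unfolding eventually_nhds by auto
  show "germ_in_image \<iota> \<sigma> z"
    unfolding germ_in_image_def
    by (rule exI[of _ "S \<inter> W"], rule exI[of _ e'])
      (use S W in \<open>auto simp: vec_eq_iff intro: hol2_on_subset[OF e']\<close>)
qed

text \<open>
  Otherwise \<open>\<sigma> = e \<iota> = e r \<sigma>\<close> near \<open>z\<close>, so \<open>e r = 1\<close> at points near \<open>z\<close>, contradicting \<open>r z = 0\<close>.
\<close>

lemma torsion_free_quotient_no_divisor:
  assumes tf: "torsion_free_quotient \<iota>" and z: "z \<noteq> 0"
    and r: "hol2_on r (- {0})" "r z = 0" and \<sigma>: "\<And>i. hol2_on (\<lambda>v. \<sigma> v $ i) (- {0})"
    and \<iota>: "\<And>v. v \<noteq> 0 \<Longrightarrow> \<iota> v = r v *s \<sigma> v"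
    and dense: "z \<in> closure {v. v \<noteq> 0 \<and> \<iota> v \<noteq> 0}"
  shows False
proof -
  \<comment> \<open>Were \<open>r\<close> zero near \<open>z\<close>, so would be \<iota>, against
    the density of points where \<iota> is nonzero.\<close>
  have "\<not> (\<forall>\<^sub>F v in nhds z. r v = 0)"
  proof
    assume "\<forall>\<^sub>F v in nhds z. r v = 0"
    then obtain S where "open S" "z \<in> S" "\<forall>v\<in>S. r v = 0" unfolding eventually_nhds by blast
    then show False using dense \<iota> unfolding closure_iff_nhds_not_empty
      by (metis (mono_tags, lifting) disjoint_iff mem_Collect_eq order_refl vector_smult_lzero)
  qed
  moreover have "germ_in_image \<iota> (\<lambda>v. r v *s \<sigma> v) z"
    unfolding germ_in_image_def
    by (rule exI[of _ "- {0}"], rule exI[of _ "\<lambda>_. 1"]) (use z \<iota> in \<open>auto intro: hol2_on_const\<close>)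
  ultimately have "germ_in_image \<iota> \<sigma> z"
    using tf[unfolded torsion_free_quotient_def, rule_format, of z "- {0}" \<sigma> r] z r(1) \<sigma> by auto
  then obtain V e where V: "open V" "z \<in> V" "hol2_on e V"
    and e: "\<And>v. v \<in> V \<Longrightarrow> \<sigma> v = e v *s \<iota> v"
    unfolding germ_in_image_def by blast
  define W where "W = {v \<in> V - {0}. e v * r v \<in> - {1}}"
  have hW: "hol2_on (\<lambda>v. e v * r v) (V - {0})"
    using V r by (intro hol2_on_mult) (auto intro: hol2_on_subset)
  have "open W"
    using continuous_open_preimage[OF hol2_on_imp_continuous_on[OF hW], of "- {1}"] V
    by (auto simp: W_def vimage_def Int_def open_Diff)
  moreover have "z \<in> W" using V z r by (simp add: W_def)
  ultimately obtain v where v: "v \<in> W" "v \<noteq> 0" "\<iota> v \<noteq> 0"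
    using dense unfolding closure_iff_nhds_not_empty by blast
  have "\<sigma> v $ k = (e v * r v) * \<sigma> v $ k" for k
  proof -
    have "\<sigma> v $ k = e v * \<iota> v $ k" using e[of v] v(1) by (simp add: W_def)
    also have "\<iota> v $ k = r v * \<sigma> v $ k" using \<iota>[OF v(2)] by simp
    finally show ?thesis by (simp only: mult.assoc)
  qed
  moreover obtain k where "\<sigma> v $ k \<noteq> 0"
    using \<iota>[of v] v by (auto simp: vec_eq_iff)
  ultimately have "e v * r v = 1" by (metis mult_cancel_right1)
  then show False using v by (simp add: W_def)
qed

lemma closure_off_axes: "closure {v :: complex \<times> complex. fst v \<noteq> 0 \<and> snd v \<noteq> 0} = UNIV"
proof -
  have "{v :: complex \<times> complex. fst v \<noteq> 0 \<and> snd v \<noteq> 0} = (- {0}) \<times> (- {0})" by auto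
  then show ?thesis by (simp add: closure_Times closure_complement)
qed

text \<open>A common zero of monomials outside the origin lies on exactly one axis, and then the
  coordinate defining that axis divides every component. Removing this divisor contradicts
  torsion-freeness.\<close>

lemma torsion_free_monomials_nonzero:
  assumes tf: "torsion_free_quotient \<iota>" and ex: "\<exists>z. z \<noteq> 0 \<and> \<iota> z \<noteq> 0" and z: "z \<noteq> 0"
    and mono: "\<And>i. \<exists>c n m. \<forall>v. v \<noteq> 0 \<longrightarrow> \<iota> v $ i = c * fst v ^ n * snd v ^ m"
  shows "\<iota> z \<noteq> 0"
proof
  assume z0: "\<iota> z = 0"
  obtain c n m where \<iota>: "\<And>v i. v \<noteq> 0 \<Longrightarrow> \<iota> v $ i = c i * fst v ^ n i * snd v ^ m i"
    using mono by metis
  obtain k where k: "c k \<noteq> 0"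
    using ex \<iota> by (metis mult_zero_left vec_eq_iff zero_index)
  have nz: "\<iota> v \<noteq> 0" "v \<noteq> 0" if v: "fst v \<noteq> 0 \<and> snd v \<noteq> 0" for v
  proof -
    show "v \<noteq> 0" using v by auto
    then have "\<iota> v $ k \<noteq> 0" using \<iota>[of v k] k v by simp
    then show "\<iota> v \<noteq> 0" by auto
  qed
  then have dense: "z \<in> closure {v. v \<noteq> 0 \<and> \<iota> v \<noteq> 0}"
    using closure_mono[of "{v. fst v \<noteq> 0 \<and> snd v \<noteq> 0}" "{v. v \<noteq> 0 \<and> \<iota> v \<noteq> 0}"] closure_off_axes
    by blast
  have ci: "c i = 0 \<or> fst z ^ n i = 0 \<or> snd z ^ m i = 0" for i
    using \<iota>[OF z, of i] z0 by auto
  consider "fst z = 0" "snd z \<noteq> 0" | "snd z = 0" "fst z \<noteq> 0"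
    using nz[of z] z0 z by (auto simp: prod_eq_iff)
  then show False
  proof cases
    case 1
    show False
    proof (rule torsion_free_quotient_no_divisor[OF tf z hol2_on_fst 1(1) _ _ dense])
      show "hol2_on (\<lambda>v. (\<chi> i. c i * fst v ^ (n i - 1) * snd v ^ m i) $ i) (- {0})" for i
        by (simp, intro hol2_on_mult hol2_on_const hol2_on_power hol2_on_fst hol2_on_snd)
      fix v :: "complex \<times> complex" assume v: "v \<noteq> 0"
      \<comment> \<open>Guards the truncated subtraction \<open>n i - 1\<close>: a component with
        exponent 0 has coefficient 0, so its factorization is trivial.\<close>
      have "c i = 0 \<or> n i \<noteq> 0" for i using ci[of i] 1 by (cases "n i") auto
      then have d: "c i = 0 \<or> fst v ^ n i = fst v * fst v ^ (n i - 1)" for i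
        by (metis power_eq_if)
      have "c i * fst v ^ n i * snd v ^ m i = fst v * (c i * fst v ^ (n i - 1) * snd v ^ m i)" for i
        using d[of i] by (elim disjE) simp_all
      then show "\<iota> v = fst v *s (\<chi> i. c i * fst v ^ (n i - 1) * snd v ^ m i)"
        by (simp add: vec_eq_iff \<iota>[OF v])
    qed
  next
    case 2
    show False
    proof (rule torsion_free_quotient_no_divisor[OF tf z hol2_on_snd 2(1) _ _ dense])
      show "hol2_on (\<lambda>v. (\<chi> i. c i * fst v ^ n i * snd v ^ (m i - 1)) $ i) (- {0})" for i
        by (simp, intro hol2_on_mult hol2_on_const hol2_on_power hol2_on_fst hol2_on_snd)
      fix v :: "complex \<times> complex" assume v: "v \<noteq> 0"
      have "c i = 0 \<or> m i \<noteq> 0" for i using ci[of i] 2 by (cases "m i") auto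
      then have d: "c i = 0 \<or> snd v ^ m i = snd v * snd v ^ (m i - 1)" for i
        by (metis power_eq_if)
      have "c i * fst v ^ n i * snd v ^ m i = snd v * (c i * fst v ^ n i * snd v ^ (m i - 1))" for i
        using d[of i] by (elim disjE) simp_all
      then show "\<iota> v = snd v *s (\<chi> i. c i * fst v ^ n i * snd v ^ (m i - 1))"
        by (simp add: vec_eq_iff \<iota>[OF v])
    qed
  qed
qed

text \<open>A torsion-free quotient would in general still allow isolated zeros of the inclusion.
  Common zeros of monomials outside the origin fill whole axes, so here torsion-freeness amounts to
  having no zeros.\<close>

lemma sub_line_bundle_iff:
  assumes "generic_hopf a b"
  shows "sub_line_bundle a b h (m, \<iota>) \<longleftrightarrow>
    m \<noteq> 0 \<and> (\<forall>i. (\<lambda>z. \<iota> z $ i) \<in> H0 a b (inverse m * summand h i)) \<and> (\<forall>z. z \<noteq> 0 \<longrightarrow> \<iota> z \<noteq> 0)"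
    (is "?L \<longleftrightarrow> ?R")
proof
  assume ?L
  then have *: "m \<noteq> 0" "\<And>i. (\<lambda>z. \<iota> z $ i) \<in> H0 a b (inverse m * summand h i)"
    "\<exists>z. z \<noteq> 0 \<and> \<iota> z \<noteq> 0" "torsion_free_quotient \<iota>"
    by (auto simp: sub_line_bundle_def)
  have "\<exists>c n m. \<forall>v. v \<noteq> 0 \<longrightarrow> \<iota> v $ i = c * fst v ^ n * snd v ^ m" for i
    using iffD1[OF H0_iff[OF assms] *(2)[of i]] by blast
  then show ?R using * torsion_free_monomials_nonzero by blast
next
  assume R: ?R
  then have "hol2_on (\<lambda>z. \<iota> z $ i) (- {0})" for i by (simp add: H0_def)
  then have "torsion_free_quotient \<iota>" using R torsion_free_quotient_if_nonzero by blast
  moreover have "\<exists>z :: complex \<times> complex. z \<noteq> 0" by (rule exI[of _ "(1, 1)"]) (simp add: zero_prod_def)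
  ultimately show ?L using R unfolding sub_line_bundle_def by blast
qed

text \<open>The equation is the vanishing of the 2 x 2 determinant with columns \<phi>\<iota> and
  \<iota>, that is, pointwise proportionality. As \<iota> has no zeros, the factor of
  proportionality is locally a quotient with nonvanishing denominator and thus holomorphic.\<close>

lemma invariant_sub_iff:
  assumes \<phi>: "\<And>i j. hol2_on (\<lambda>v. \<phi> v $ i $ j) (- {0})"
    and \<iota>: "\<And>i. hol2_on (\<lambda>v. \<iota> v $ i) (- {0})" and nz: "\<And>z. z \<noteq> 0 \<Longrightarrow> \<iota> z \<noteq> 0"
  shows "invariant_sub \<phi> \<iota> \<longleftrightarrow>
    (\<forall>z. z \<noteq> 0 \<longrightarrow> (\<phi> z $ 1 $ 1 * \<iota> z $ 1 + \<phi> z $ 1 $ 2 * \<iota> z $ 2) * \<iota> z $ 2 =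
      (\<phi> z $ 2 $ 1 * \<iota> z $ 1 + \<phi> z $ 2 $ 2 * \<iota> z $ 2) * \<iota> z $ 1)"
    (is "_ \<longleftrightarrow> ?R")
proof
  have mv: "(\<phi> v *v \<iota> v) $ i = \<phi> v $ i $ 1 * \<iota> v $ 1 + \<phi> v $ i $ 2 * \<iota> v $ 2" for v i
    by (simp add: matrix_vector_mult_def sum_2)
  show ?R if inv: "invariant_sub \<phi> \<iota>"
  proof (intro allI impI)
    fix z :: "complex \<times> complex" assume "z \<noteq> 0"
    then obtain e where e: "\<phi> z *v \<iota> z = e *s \<iota> z"
      using inv unfolding invariant_sub_def germ_in_image_def by blast
    have "(\<phi> z *v \<iota> z) $ 1 * \<iota> z $ 2 = (\<phi> z *v \<iota> z) $ 2 * \<iota> z $ 1"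
      unfolding e by simp
    then show "(\<phi> z $ 1 $ 1 * \<iota> z $ 1 + \<phi> z $ 1 $ 2 * \<iota> z $ 2) * \<iota> z $ 2 =
      (\<phi> z $ 2 $ 1 * \<iota> z $ 1 + \<phi> z $ 2 $ 2 * \<iota> z $ 2) * \<iota> z $ 1"
      unfolding mv .
  qed
  assume R: ?R
  show "invariant_sub \<phi> \<iota>"
    unfolding invariant_sub_def
  proof (intro allI impI)
    fix z :: "complex \<times> complex" assume z: "z \<noteq> 0"
    obtain k where k: "\<iota> z $ k \<noteq> 0" using nz[OF z] by (auto simp: vec_eq_iff)
    obtain N where N: "open N" "z \<in> N" "N \<subseteq> - {0}" "\<And>v. v \<in> N \<Longrightarrow> \<iota> v $ k \<noteq> 0"
      using hol2_on_nonzero_nhd[OF \<iota>[of k] z k] by blast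
    define e where "e v = (\<phi> v *v \<iota> v) $ k * inverse (\<iota> v $ k)" for v
    have add: "hol2_on (\<lambda>v. f v + g v) S" if "hol2_on f S" "hol2_on g S" for f g S
      using hol2_on_diff[OF that(1) hol2_on_diff[OF hol2_on_const[of 0] that(2)]] by simp
    have "hol2_on e N"
      unfolding e_def mv using N(3,4) \<phi> \<iota>
      by (intro hol2_on_mult hol2_on_inverse add) (blast intro: hol2_on_subset)+
    moreover have "\<phi> v *v \<iota> v = e v *s \<iota> v" if v: "v \<in> N" for v
    proof -
      have "(\<phi> v *v \<iota> v) $ 1 * \<iota> v $ 2 = (\<phi> v *v \<iota> v) $ 2 * \<iota> v $ 1"
        unfolding mv using R[rule_format, of v] N(3) v by blast
      then have "(\<phi> v *v \<iota> v) $ i * \<iota> v $ k = (\<phi> v *v \<iota> v) $ k * \<iota> v $ i" for i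
        by (cases i rule: exhaust_2[THEN disjE]; cases k rule: exhaust_2[THEN disjE]) auto
      then show ?thesis using N(4)[OF v] by (simp add: vec_eq_iff e_def field_simps)
    qed
    ultimately show "germ_in_image \<iota> (\<lambda>v. \<phi> v *v \<iota> v) z"
      unfolding germ_in_image_def using N by blast
  qed
qed

text \<open>The quadratic form \<phi>\<iota> \<and> \<iota> in the components of \<iota>; its zero
  lines are the eigenlines of \<phi>.\<close>

definition eigen_inclusion ::
  "(complex \<times> complex \<Rightarrow> complex^2^2) \<Rightarrow> (complex \<times> complex \<Rightarrow> complex^2) \<Rightarrow> bool" where
  "eigen_inclusion \<phi> \<iota> \<longleftrightarrow>
    (\<forall>z. z \<noteq> 0 \<longrightarrow> (\<phi> z $ 1 $ 1 * \<iota> z $ 1 + \<phi> z $ 1 $ 2 * \<iota> z $ 2) * \<iota> z $ 2 =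
      (\<phi> z $ 2 $ 1 * \<iota> z $ 1 + \<phi> z $ 2 $ 2 * \<iota> z $ 2) * \<iota> z $ 1)"

lemma H0_hol2: "s \<in> H0 a b \<tau> \<Longrightarrow> hol2_on s (- {0})"
  by (simp add: H0_def)

lemma vec2_nonzero_iff: "x \<noteq> 0 \<longleftrightarrow> x $ 1 \<noteq> 0 \<or> x $ 2 \<noteq> 0" for x :: "complex^2"
  by (auto simp: vec_eq_iff forall_2)

text \<open>The statements for \<open>L\<^sub>a\<close> and \<open>L\<^sub>b\<close> are instances of one: \<open>(u, v)\<close> is \<open>(x, y)\<close> or \<open>(y, x)\<close>.\<close>

locale hopf_coords =
  fixes a b \<alpha> \<beta> :: complex and u v :: "complex \<times> complex \<Rightarrow> complex"
  assumes generic: "generic_hopf a b"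
    and coords: "u = fst \<and> v = snd \<and> \<alpha> = a \<and> \<beta> = b \<or> u = snd \<and> v = fst \<and> \<alpha> = b \<and> \<beta> = a"
begin

lemma norms: "0 < cmod \<alpha>" "cmod \<alpha> < 1" "0 < cmod \<beta>" "cmod \<beta> < 1"
  using coords generic by (auto simp: generic_hopf_def)

lemma nz [simp]: "\<alpha> \<noteq> 0" "\<beta> \<noteq> 0"
  using norms by auto

lemma monomial_eq_iff: "\<alpha> ^ i * \<beta> ^ j = \<alpha> ^ i' * \<beta> ^ j' \<longleftrightarrow> i = i' \<and> j = j'"
proof -
  have ab: "0 < cmod a" "cmod a < 1" "0 < cmod b" "cmod b < 1"
    "0 < k1 \<Longrightarrow> 0 < k2 \<Longrightarrow> a ^ k1 \<noteq> b ^ k2" for k1 k2 :: nat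
    using generic by (auto simp: generic_hopf_def)
  have "a ^ i * b ^ j = a ^ i' * b ^ j' \<longleftrightarrow> i = i' \<and> j = j'" for i j i' j'
    using monomial_inj[OF ab, of i j i' j'] by auto
  from this[of i j i' j'] this[of j i j' i'] show ?thesis
    using coords by (auto simp: mult.commute)
qed

lemma coords_nonzero_iff: "z \<noteq> 0 \<longleftrightarrow> u z \<noteq> 0 \<or> v z \<noteq> 0"
  using coords by (cases z) (auto simp: zero_prod_def)

lemma ex_point: "\<exists>z. u z = p \<and> v z = q"
  using coords by auto

lemma point:
  assumes "p \<noteq> 0 \<or> q \<noteq> 0"
  obtains z where "z \<noteq> 0" "u z = p" "v z = q"
  using ex_point[of p q] assms coords_nonzero_iff by blast

section \<open>Sections and inclusions in the coordinates \<open>u\<close>, \<open>v\<close>\<close>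

lemma H0_coords_iff: "s \<in> H0 a b \<tau> \<longleftrightarrow>
    (\<exists>c i j. (c = 0 \<or> \<tau> = \<alpha> ^ i * \<beta> ^ j) \<and> (\<forall>z. z \<noteq> 0 \<longrightarrow> s z = c * u z ^ i * v z ^ j))"
proof -
  from coords consider "u = fst" "v = snd" "\<alpha> = a" "\<beta> = b" | "u = snd" "v = fst" "\<alpha> = b" "\<beta> = a"
    by blast
  then show ?thesis
  proof cases
    case 1
    then show ?thesis by (simp only: H0_iff[OF generic])
  next
    case 2
    have "(\<exists>c i j. (c = 0 \<or> \<tau> = a ^ i * b ^ j) \<and> (\<forall>z. z \<noteq> 0 \<longrightarrow> s z = c * fst z ^ i * snd z ^ j)) \<longleftrightarrow>
        (\<exists>c j i. (c = 0 \<or> \<tau> = b ^ j * a ^ i) \<and> (\<forall>z. z \<noteq> 0 \<longrightarrow> s z = c * snd z ^ j * fst z ^ i))"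
      unfolding mult.commute[of "a ^ _"] mult.assoc mult.commute[of "fst _ ^ _"]
      by (rule iff_exI, rule ex_comm)
    then show ?thesis using 2 by (simp only: H0_iff[OF generic])
  qed
qed

lemma H0_cases:
  assumes "s \<in> H0 a b \<tau>"
  obtains c i j where "c = 0 \<or> \<tau> = \<alpha> ^ i * \<beta> ^ j" "\<And>z. z \<noteq> 0 \<Longrightarrow> s z = c * u z ^ i * v z ^ j"
  using assms H0_coords_iff by blast

lemma H0I:
  "c = 0 \<or> \<tau> = \<alpha> ^ i * \<beta> ^ j \<Longrightarrow> (\<And>z. z \<noteq> 0 \<Longrightarrow> s z = c * u z ^ i * v z ^ j) \<Longrightarrow> s \<in> H0 a b \<tau>"
  using H0_coords_iff by blast

lemma H0_zero: "(\<And>z. z \<noteq> 0 \<Longrightarrow> s z = 0) \<Longrightarrow> s \<in> H0 a b \<tau>"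
  by (rule H0I[of 0 _ 0 0]) auto

lemma H0_trivial:
  assumes "s \<in> H0 a b \<tau>" "\<And>i j. \<tau> \<noteq> \<alpha> ^ i * \<beta> ^ j" "z \<noteq> 0"
  shows "s z = 0"
  using H0_cases[OF assms(1)] assms(2,3) by (metis mult_zero_left)

text \<open>Since exponents are determined by the multiplier, they can be prescribed in advance, and
  the zero section fits any of them.\<close>

lemma H0_monomial:
  assumes "s \<in> H0 a b \<tau>" "\<tau> = \<alpha> ^ i * \<beta> ^ j"
  obtains c where "\<And>z. z \<noteq> 0 \<Longrightarrow> s z = c * u z ^ i * v z ^ j"
proof (rule H0_cases[OF assms(1)])
  fix c i' j'
  assume c: "c = 0 \<or> \<tau> = \<alpha> ^ i' * \<beta> ^ j'" and s: "\<And>z. z \<noteq> 0 \<Longrightarrow> s z = c * u z ^ i' * v z ^ j'"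
  from c show thesis
  proof
    assume "c = 0"
    then show thesis using s that[of 0] by simp
  next
    assume "\<tau> = \<alpha> ^ i' * \<beta> ^ j'"
    then have "i = i'" "j = j'" using assms(2) monomial_eq_iff by auto
    then show thesis using s that by blast
  qed
qed

lemma monomial_nonvanishing:
  assumes "\<And>z. z \<noteq> 0 \<Longrightarrow> c * u z ^ i * v z ^ j \<noteq> 0"
  shows "c \<noteq> 0 \<and> i = 0 \<and> j = 0"
proof -
  obtain z where "z \<noteq> 0" "u z = 1" "v z = 0" using point[of 1 0] by auto
  then have "c * 0 ^ j \<noteq> 0" using assms[of z] by simp
  moreover obtain z where "z \<noteq> 0" "u z = 0" "v z = 1" using point[of 0 1] by auto
  then have "c * 0 ^ i \<noteq> 0" using assms[of z] by simp
  ultimately show ?thesis by (auto simp: zero_power)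
qed

text \<open>A monomial that involves a coordinate vanishes on the corresponding punctured axis, so
  only constants survive. In particular isomorphic line bundles have equal multipliers, and two
  inclusions give the same sub-line bundle only if they differ by a constant.\<close>

lemma H0_nowhere_vanishing:
  assumes s: "s \<in> H0 a b \<tau>" "\<And>z. z \<noteq> 0 \<Longrightarrow> s z \<noteq> 0"
  obtains c where "c \<noteq> 0" "\<tau> = 1" "\<And>z. z \<noteq> 0 \<Longrightarrow> s z = c"
proof (rule H0_cases[OF s(1)])
  fix c i j
  assume c: "c = 0 \<or> \<tau> = \<alpha> ^ i * \<beta> ^ j" and s': "\<And>z. z \<noteq> 0 \<Longrightarrow> s z = c * u z ^ i * v z ^ j"
  then have "c \<noteq> 0 \<and> i = 0 \<and> j = 0" using s(2) monomial_nonvanishing[of c i j] by metis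
  then show thesis using that[of c] c s' by simp
qed

lemma same_subD:
  assumes "same_sub a b (m, \<iota>) (m', \<iota>')"
  obtains c where "c \<noteq> 0" "m = m'" "\<And>z. z \<noteq> 0 \<Longrightarrow> \<iota> z = c *s \<iota>' z"
proof -
  obtain w where w: "w \<in> H0 a b (inverse m * m')" "nowhere_vanishing w"
    "\<And>z. z \<noteq> 0 \<Longrightarrow> \<iota> z = w z *s \<iota>' z"
    using assms unfolding same_sub_def by auto
  obtain c where c: "c \<noteq> 0" "inverse m * m' = 1" "\<And>z. z \<noteq> 0 \<Longrightarrow> w z = c"
    using H0_nowhere_vanishing[OF w(1)] w(2) unfolding nowhere_vanishing_def by metis
  then have "m = m'" by (cases "m = 0") (auto simp: field_simps)
  then show thesis using that c w(3) by metis
qed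

lemma same_subI:
  assumes "m \<noteq> 0" "c \<noteq> 0" "\<And>z. z \<noteq> 0 \<Longrightarrow> \<iota> z = c *s \<iota>' z"
  shows "same_sub a b (m, \<iota>) (m, \<iota>')"
proof -
  have "(\<lambda>_. c) \<in> H0 a b (inverse m * m)"
    by (rule H0I[of c _ 0 0]) (use assms in auto)
  then show ?thesis
    using assms unfolding same_sub_def nowhere_vanishing_def by (auto intro!: bexI[of _ "\<lambda>_. c"])
qed

text \<open>All defining conditions survive multiplication of the inclusion by a nonzero constant,
  and \<open>same_sub\<close> allows nothing else. Hence it is enough to check the listed
  representatives and to match every solution with one of them.\<close>

lemma invariant_subs_areI:
  assumes \<phi>: "\<And>i j. hol2_on (\<lambda>v. \<phi> v $ i $ j) (- {0})"
    and S: "\<And>m \<iota>. (m, \<iota>) \<in> S \<Longrightarrow> m \<noteq> 0 \<and> (\<forall>i. (\<lambda>z. \<iota> z $ i) \<in> H0 a b (inverse m * summand h i)) \<and>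
      (\<forall>z. z \<noteq> 0 \<longrightarrow> \<iota> z \<noteq> 0) \<and> eigen_inclusion \<phi> \<iota>"
    and complete: "\<And>m \<iota>. m \<noteq> 0 \<Longrightarrow> (\<And>i. (\<lambda>z. \<iota> z $ i) \<in> H0 a b (inverse m * summand h i)) \<Longrightarrow>
      (\<And>z. z \<noteq> 0 \<Longrightarrow> \<iota> z \<noteq> 0) \<Longrightarrow> eigen_inclusion \<phi> \<iota> \<Longrightarrow> \<exists>M'\<in>S. same_sub a b (m, \<iota>) M'"
  shows "invariant_subs_are a b (h, \<phi>) S"
proof -
  have iff: "sub_line_bundle a b h (m, \<iota>) \<and> invariant_sub \<phi> \<iota> \<longleftrightarrow>
      m \<noteq> 0 \<and> (\<forall>i. (\<lambda>z. \<iota> z $ i) \<in> H0 a b (inverse m * summand h i)) \<and>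
      (\<forall>z. z \<noteq> 0 \<longrightarrow> \<iota> z \<noteq> 0) \<and> eigen_inclusion \<phi> \<iota>" for m \<iota>
    using sub_line_bundle_iff[OF generic, of h m \<iota>] invariant_sub_iff[OF \<phi>, of \<iota>] H0_hol2
    unfolding eigen_inclusion_def by blast
  have same_back: "m \<noteq> 0 \<and> (\<forall>i. (\<lambda>z. \<iota> z $ i) \<in> H0 a b (inverse m * summand h i)) \<and>
      (\<forall>z. z \<noteq> 0 \<longrightarrow> \<iota> z \<noteq> 0) \<and> eigen_inclusion \<phi> \<iota>"
    if M: "(m', \<iota>') \<in> S" "same_sub a b (m, \<iota>) (m', \<iota>')" for m \<iota> m' \<iota>'
  proof -
    obtain c where c: "c \<noteq> 0" "m = m'" "\<And>z. z \<noteq> 0 \<Longrightarrow> \<iota> z = c *s \<iota>' z"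
      using same_subD[OF M(2)] by blast
    note S' = S[OF M(1)]
    have "(\<lambda>z. \<iota> z $ i) \<in> H0 a b (inverse m * summand h i)" for i
    proof -
      have H: "(\<lambda>z. \<iota>' z $ i) \<in> H0 a b (inverse m * summand h i)" using S' c(2) by blast
      obtain d k l where d: "d = 0 \<or> inverse m * summand h i = \<alpha> ^ k * \<beta> ^ l"
        "\<And>z. z \<noteq> 0 \<Longrightarrow> \<iota>' z $ i = d * u z ^ k * v z ^ l"
        using iffD1[OF H0_coords_iff H] by blast
      then show ?thesis by (intro H0I[of "c * d" _ k l]) (auto simp: c(3))
    qed
    moreover have "\<iota> z \<noteq> 0" if "z \<noteq> 0" for z
    proof -
      have "\<iota>' z \<noteq> 0" using S' that by blast
      then show ?thesis using c(1) by (auto simp: c(3)[OF that] vec_eq_iff)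
    qed
    moreover have "eigen_inclusion \<phi> \<iota>"
      unfolding eigen_inclusion_def
    proof (intro allI impI)
      fix z :: "complex \<times> complex" assume z: "z \<noteq> 0"
      have eq: "(\<phi> z $ 1 $ 1 * \<iota>' z $ 1 + \<phi> z $ 1 $ 2 * \<iota>' z $ 2) * \<iota>' z $ 2 =
          (\<phi> z $ 2 $ 1 * \<iota>' z $ 1 + \<phi> z $ 2 $ 2 * \<iota>' z $ 2) * \<iota>' z $ 1"
        using S' z unfolding eigen_inclusion_def by blast
      \<comment> \<open>Both sides of the eigenline equation are homogeneous of degree 2 in the
        inclusion.\<close>
      have scale: "(p * (c * f) + q * (c * g)) * (c * h) = (c * c) * ((p * f + q * g) * h)" for p q f g h
        by (simp add: algebra_simps)
      then show "(\<phi> z $ 1 $ 1 * \<iota> z $ 1 + \<phi> z $ 1 $ 2 * \<iota> z $ 2) * \<iota> z $ 2 =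
          (\<phi> z $ 2 $ 1 * \<iota> z $ 1 + \<phi> z $ 2 $ 2 * \<iota> z $ 2) * \<iota> z $ 1"
        by (simp only: c(3)[OF z] vector_smult_component scale eq)
    qed
    ultimately show ?thesis using S' c(2) by simp
  qed
  show ?thesis
    unfolding invariant_subs_are_def prod.case
  proof (intro allI)
    fix M :: "complex \<times> (complex \<times> complex \<Rightarrow> complex^2)"
    obtain m \<iota> where M: "M = (m, \<iota>)" by (cases M)
    show "sub_line_bundle a b h M \<and> invariant_sub \<phi> (snd M) \<longleftrightarrow> (\<exists>M'\<in>S. same_sub a b M M')"
      unfolding M snd_conv iff using complete same_back by (metis surj_pair)
  qed
qed

text \<open>Coprimality of \<open>u\<close> and \<open>v ^ k\<close> forces \<open>v ^ k\<close> to
  divide \<open>f\<close> and \<open>u\<close> to divide \<open>g\<close>; the cofactor is common to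
  both, and the absence of common zeros makes it constant.\<close>

lemma monomials_cross:
  assumes AB: "A \<noteq> 0" "B \<noteq> 0" and k: "0 < k"
    and f: "\<And>z. z \<noteq> 0 \<Longrightarrow> f z = c * u z ^ i * v z ^ j"
    and g: "\<And>z. z \<noteq> 0 \<Longrightarrow> g z = d * u z ^ p * v z ^ q"
    and eq: "\<And>z. u z \<noteq> 0 \<Longrightarrow> v z \<noteq> 0 \<Longrightarrow> A * u z * f z = B * v z ^ k * g z"
    and fg: "\<And>z. z \<noteq> 0 \<Longrightarrow> f z \<noteq> 0 \<or> g z \<noteq> 0"
  shows "A * c = B * d \<and> i = 0 \<and> j = k \<and> p = 1 \<and> q = 0"
proof -
  have e: "A * c * x ^ Suc i * y ^ j = B * d * x ^ p * y ^ (k + q)" if xy: "x \<noteq> 0" "y \<noteq> 0" for x y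
  proof -
    obtain z where z: "z \<noteq> 0" "u z = x" "v z = y" using point[of x y] xy by blast
    have "A * x * (c * x ^ i * y ^ j) = B * y ^ k * (d * x ^ p * y ^ q)"
      using eq[of z] f[OF z(1)] g[OF z(1)] xy z by simp
    then show ?thesis by (simp add: power_add ac_simps)
  qed
  have cd: "A * c = B * d" using e[of 1 1] by simp
  have "c \<noteq> 0"
  proof
    assume "c = 0"
    then have "d = 0" using cd AB by simp
    obtain z where "z \<noteq> 0" "u z = 1" "v z = 1" using point[of 1 1] by auto
    then show False using fg f g \<open>c = 0\<close> \<open>d = 0\<close> by fastforce
  qed
  then have cd0: "B * d \<noteq> 0" using cd AB by auto
  \<comment> \<open>Evaluating at the points (2, 1) and (1, 2) reads off the two exponents, because
    powers of 2 are distinct.\<close>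
  have two: "m = n" if "(2::complex) ^ m = 2 ^ n" for m n
  proof -
    have "(2::real) ^ m = 2 ^ n" using arg_cong[OF that, of cmod] by (simp add: norm_power)
    then show ?thesis by simp
  qed
  have "Suc i = p" "j = k + q"
    using e[of 2 1] e[of 1 2] cd cd0 two by auto
  \<comment> \<open>On the axis v = 0 the function \<open>f\<close> vanishes, as its exponent j is
    at least k > 0, so \<open>g\<close> cannot involve \<open>v\<close>. Symmetrically
    \<open>g\<close> vanishes on u = 0, so \<open>f\<close> cannot involve \<open>u\<close>.\<close>
  moreover obtain z where "z \<noteq> 0" "u z = 1" "v z = 0" using point[of 1 0] by auto
  then have "c * 0 ^ j \<noteq> 0 \<or> d * 0 ^ q \<noteq> 0" using fg[of z] f[of z] g[of z] by simp
  moreover obtain z where "z \<noteq> 0" "u z = 0" "v z = 1" using point[of 0 1] by auto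
  then have "c * 0 ^ i \<noteq> 0 \<or> d * 0 ^ p \<noteq> 0" using fg[of z] f[of z] g[of z] by simp
  ultimately show ?thesis using k cd by (auto simp: zero_power split: if_splits)
qed

section \<open>Invariant sub-line bundles of the normal forms\<close>

lemma hol2_monomial: "hol2_on (\<lambda>z. c * u z ^ i * v z ^ j) U"
  using coords by (auto intro!: hol2_on_mult hol2_on_power hol2_on_const hol2_on_fst hol2_on_snd)

lemma hol2_uv: "hol2_on (\<lambda>z. 0) U" "hol2_on (\<lambda>z. 1) U" "hol2_on (\<lambda>z. c * u z) U" "hol2_on (\<lambda>z. - (c * u z)) U"
  "hol2_on (\<lambda>z. c * (u z)\<^sup>2) U" "hol2_on (\<lambda>z. v z ^ j) U"
  using hol2_monomial[of 0 0 0 U] hol2_monomial[of 1 0 0 U] hol2_monomial[of c 1 0 U]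
    hol2_monomial[of "- c" 1 0 U] hol2_monomial[of c 2 0 U] hol2_monomial[of 1 0 j U] by simp_all

lemma H0_zero_const: "(\<lambda>z. 0) \<in> H0 a b \<tau>"
  by (rule H0_zero) simp

lemma sub_cases:
  assumes H: "\<And>i. (\<lambda>z. \<iota> z $ i) \<in> H0 a b (inverse m * summand h i)"
    and nonzero: "\<And>z. z \<noteq> 0 \<Longrightarrow> \<iota> z \<noteq> 0"
  obtains c i j d p q where
    "c = 0 \<or> inverse m = \<alpha> ^ i * \<beta> ^ j" "d = 0 \<or> inverse m * h = \<alpha> ^ p * \<beta> ^ q"
    "\<And>z. z \<noteq> 0 \<Longrightarrow> \<iota> z $ 1 = c * u z ^ i * v z ^ j" "\<And>z. z \<noteq> 0 \<Longrightarrow> \<iota> z $ 2 = d * u z ^ p * v z ^ q"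
    "\<And>z. z \<noteq> 0 \<Longrightarrow> \<iota> z $ 1 \<noteq> 0 \<or> \<iota> z $ 2 \<noteq> 0"
proof -
  obtain c i j where 1: "c = 0 \<or> inverse m = \<alpha> ^ i * \<beta> ^ j"
    "\<And>z. z \<noteq> 0 \<Longrightarrow> \<iota> z $ 1 = c * u z ^ i * v z ^ j"
    using H0_cases[OF H[of 1]] by (auto simp: summand_def)
  obtain d p q where 2: "d = 0 \<or> inverse m * h = \<alpha> ^ p * \<beta> ^ q"
    "\<And>z. z \<noteq> 0 \<Longrightarrow> \<iota> z $ 2 = d * u z ^ p * v z ^ q"
    using H0_cases[OF H[of 2]] by (auto simp: summand_def)
  show thesis by (rule that[OF 1(1) 2(1) 1(2) 2(2)]) (use nonzero vec2_nonzero_iff in auto)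
qed

text \<open>With components f, g of the inclusion the equation is f^2 = t u^2 g^2, that is, f = r u
  g for a square root r of t. For t = 0 the two listed inclusions coincide.\<close>

lemma invariant_subs_antidiag:
  "invariant_subs_are a b (inverse \<alpha>, \<lambda>z. mat2 0 (t * (u z)\<^sup>2) 1 0)
    {(inverse \<alpha>, \<lambda>z. vec2 (u z * csqrt t) 1), (inverse \<alpha>, \<lambda>z. vec2 (- u z * csqrt t) 1)}"
proof (rule invariant_subs_areI)
  show "hol2_on (\<lambda>z. mat2 0 (t * (u z)\<^sup>2) 1 0 $ i $ j) (- {0})" for i j
    using exhaust_2[of i] exhaust_2[of j] by (auto simp: hol2_uv)
next
  fix m :: complex and \<iota> :: "complex \<times> complex \<Rightarrow> complex^2"
  assume "(m, \<iota>) \<in> {(inverse \<alpha>, \<lambda>z. vec2 (u z * csqrt t) 1), (inverse \<alpha>, \<lambda>z. vec2 (- u z * csqrt t) 1)}"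
  then obtain r where r: "r\<^sup>2 = t" "m = inverse \<alpha>" "\<iota> = (\<lambda>z. vec2 (r * u z) 1)"
  proof -
    have "(- csqrt t)\<^sup>2 = t" "(csqrt t)\<^sup>2 = t" by simp_all
    then show thesis
      using that[of "csqrt t"] that[of "- csqrt t"]
        \<open>(m, \<iota>) \<in> {(inverse \<alpha>, \<lambda>z. vec2 (u z * csqrt t) 1), (inverse \<alpha>, \<lambda>z. vec2 (- u z * csqrt t) 1)}\<close>
      by (auto simp: mult.commute[of "u _"])
  qed
  have "(\<lambda>z. \<iota> z $ i) \<in> H0 a b (inverse m * summand (inverse \<alpha>) i)" for i
    using exhaust_2[of i]
    by (auto simp: r summand_def intro: H0I[of r _ 1 0] H0I[of 1 _ 0 0])
  moreover have "\<iota> z \<noteq> 0" for z by (simp add: r vec2_nonzero_iff)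
  moreover have "eigen_inclusion (\<lambda>z. mat2 0 (t * (u z)\<^sup>2) 1 0) \<iota>"
    by (auto simp: eigen_inclusion_def r(3) r(1)[symmetric] power2_eq_square)
  ultimately show "m \<noteq> 0 \<and> (\<forall>i. (\<lambda>z. \<iota> z $ i) \<in> H0 a b (inverse m * summand (inverse \<alpha>) i)) \<and>
      (\<forall>z. z \<noteq> 0 \<longrightarrow> \<iota> z \<noteq> 0) \<and> eigen_inclusion (\<lambda>z. mat2 0 (t * (u z)\<^sup>2) 1 0) \<iota>"
    by (simp add: r(2))
next
  fix m :: complex and \<iota> :: "complex \<times> complex \<Rightarrow> complex^2"
  assume m: "m \<noteq> 0" and H: "\<And>i. (\<lambda>z. \<iota> z $ i) \<in> H0 a b (inverse m * summand (inverse \<alpha>) i)"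
    and nonzero: "\<And>z. z \<noteq> 0 \<Longrightarrow> \<iota> z \<noteq> 0" and eig: "eigen_inclusion (\<lambda>z. mat2 0 (t * (u z)\<^sup>2) 1 0) \<iota>"
  have e: "t * (u z)\<^sup>2 * (\<iota> z $ 2)\<^sup>2 = (\<iota> z $ 1)\<^sup>2" if "z \<noteq> 0" for z
    using eig[unfolded eigen_inclusion_def, rule_format, OF that] by (simp add: power2_eq_square mult.assoc)
  \<comment> \<open>A zero of the second component would be a zero of the first; so the second
    component is constant and determines \<open>m\<close>.\<close>
  have "\<iota> z $ 2 \<noteq> 0" if "z \<noteq> 0" for z
    using e[OF that] nonzero[OF that] by (auto simp: vec2_nonzero_iff)
  then obtain d where d: "d \<noteq> 0" "inverse m * inverse \<alpha> = 1" "\<And>z. z \<noteq> 0 \<Longrightarrow> \<iota> z $ 2 = d"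
    using H0_nowhere_vanishing[OF H[of 2]] by (auto simp: summand_def)
  have m: "m = inverse \<alpha>" using d(2) m by (auto simp: field_simps)
  then obtain c where c: "\<And>z. z \<noteq> 0 \<Longrightarrow> \<iota> z $ 1 = c * u z ^ 1 * v z ^ 0"
    using H0_monomial[OF H[of 1], of 1 0] by (auto simp: summand_def)
  obtain z where "z \<noteq> 0" "u z = 1" "v z = 0" using point[of 1 0] by auto
  then have "t * d\<^sup>2 = c\<^sup>2" using e[of z] c[of z] d(3)[of z] by simp
  then have "(c / d)\<^sup>2 = t" using d(1) by (simp add: field_simps power2_eq_square)
  then have "(c / d)\<^sup>2 = (csqrt t)\<^sup>2" by simp
  then consider "c / d = csqrt t" | "c / d = - csqrt t" using power2_eq_iff by blast
  then show "\<exists>M'\<in>{(inverse \<alpha>, \<lambda>z. vec2 (u z * csqrt t) 1), (inverse \<alpha>, \<lambda>z. vec2 (- u z * csqrt t) 1)}.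
      same_sub a b (m, \<iota>) M'"
  proof cases
    case 1
    then have "c = d * csqrt t" using d(1) by (simp add: field_simps)
    then have "same_sub a b (inverse \<alpha>, \<iota>) (inverse \<alpha>, \<lambda>z. vec2 (u z * csqrt t) 1)"
      by (intro same_subI[of _ d]) (auto simp: d vec_eq_iff forall_2 c)
    then show ?thesis using m by blast
  next
    case 2
    then have "c = - (d * csqrt t)" using d(1) by (simp add: field_simps)
    then have "same_sub a b (inverse \<alpha>, \<iota>) (inverse \<alpha>, \<lambda>z. vec2 (- u z * csqrt t) 1)"
      by (intro same_subI[of _ d]) (auto simp: d vec_eq_iff forall_2 c)
    then show ?thesis using m by blast
  qed
qed

text \<open>The quadratic form splits as g (2 s u f + v^k g). A monomial g is either identically
  zero, which gives the first summand, or nonzero off the axes, where the second factor must vanish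
  and \<open>monomials_cross\<close> applies.\<close>

lemma invariant_subs_upper:
  assumes s: "s \<noteq> 0" and k: "0 < k"
  shows "invariant_subs_are a b (\<alpha> * inverse (\<beta> ^ k), \<lambda>z. mat2 (s * u z) (v z ^ k) 0 (- (s * u z)))
    {(1, \<lambda>z. vec2 1 0), (inverse (\<beta> ^ k), \<lambda>z. vec2 (v z ^ k) (- 2 * s * u z))}"
    (is "invariant_subs_are a b (?h, ?\<phi>) ?S")
proof (rule invariant_subs_areI)
  show "hol2_on (\<lambda>z. ?\<phi> z $ i $ j) (- {0})" for i j
    using exhaust_2[of i] exhaust_2[of j] by (auto simp: hol2_uv)
next
  fix m :: complex and \<iota> :: "complex \<times> complex \<Rightarrow> complex^2"
  assume "(m, \<iota>) \<in> ?S"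
  then consider "m = 1" "\<iota> = (\<lambda>z. vec2 1 0)" |
    "m = inverse (\<beta> ^ k)" "\<iota> = (\<lambda>z. vec2 (v z ^ k) (- 2 * s * u z))" by auto
  then show "m \<noteq> 0 \<and> (\<forall>i. (\<lambda>z. \<iota> z $ i) \<in> H0 a b (inverse m * summand ?h i)) \<and>
      (\<forall>z. z \<noteq> 0 \<longrightarrow> \<iota> z \<noteq> 0) \<and> eigen_inclusion ?\<phi> \<iota>"
  proof cases
    case 1
    then show ?thesis
      by (auto simp: forall_2 summand_def vec2_nonzero_iff eigen_inclusion_def intro: H0_zero_const H0I[of 1 _ 0 0])
  next
    case 2
    have "(\<lambda>z. v z ^ k) \<in> H0 a b (\<beta> ^ k)" "(\<lambda>z. - (2 * s * u z)) \<in> H0 a b \<alpha>"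
      by (auto intro: H0I[of 1 _ 0 k] H0I[of "- 2 * s" _ 1 0])
    then show ?thesis using 2 s
      by (auto simp: forall_2 summand_def vec2_nonzero_iff eigen_inclusion_def coords_nonzero_iff algebra_simps)
  qed
next
  fix m :: complex and \<iota> :: "complex \<times> complex \<Rightarrow> complex^2"
  assume m: "m \<noteq> 0" and H: "\<And>i. (\<lambda>z. \<iota> z $ i) \<in> H0 a b (inverse m * summand ?h i)"
    and nonzero: "\<And>z. z \<noteq> 0 \<Longrightarrow> \<iota> z \<noteq> 0" and eig: "eigen_inclusion ?\<phi> \<iota>"
  have e: "\<iota> z $ 2 * (2 * s * u z * \<iota> z $ 1 + v z ^ k * \<iota> z $ 2) = 0" if "z \<noteq> 0" for z
    using eig[unfolded eigen_inclusion_def, rule_format, OF that] by (simp add: algebra_simps)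
  obtain c i j d p q where
    c: "c = 0 \<or> inverse m = \<alpha> ^ i * \<beta> ^ j" and d: "d = 0 \<or> inverse m * ?h = \<alpha> ^ p * \<beta> ^ q"
    and f: "\<And>z. z \<noteq> 0 \<Longrightarrow> \<iota> z $ 1 = c * u z ^ i * v z ^ j"
    and g: "\<And>z. z \<noteq> 0 \<Longrightarrow> \<iota> z $ 2 = d * u z ^ p * v z ^ q"
    and fg: "\<And>z. z \<noteq> 0 \<Longrightarrow> \<iota> z $ 1 \<noteq> 0 \<or> \<iota> z $ 2 \<noteq> 0"
    using sub_cases[of \<iota> m ?h] H nonzero by blast
  show "\<exists>M'\<in>?S. same_sub a b (m, \<iota>) M'"
  proof (cases "d = 0")
    case True
    \<comment> \<open>Without the second component the first one has no zeros, so it is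
      constant.\<close>
    then have c0: "c \<noteq> 0 \<and> i = 0 \<and> j = 0"
      using fg f g monomial_nonvanishing[of c i j] by (metis mult_zero_left)
    then have "m = 1" using c by simp
    moreover have "same_sub a b (1, \<iota>) (1, \<lambda>z. vec2 1 0)"
      by (rule same_subI[of _ c]) (use c0 True f g in \<open>auto simp: vec_eq_iff forall_2\<close>)
    ultimately show ?thesis by blast
  next
    case False
    have "2 * s * c = - 1 * d \<and> i = 0 \<and> j = k \<and> p = 1 \<and> q = 0"
    proof (rule monomials_cross[OF _ _ k f g _ fg])
      fix z assume uv: "u z \<noteq> 0" "v z \<noteq> 0"
      then have z: "z \<noteq> 0" by (simp add: coords_nonzero_iff)
      then have "\<iota> z $ 2 \<noteq> 0" using g uv False by simp
      then show "2 * s * u z * \<iota> z $ 1 = - 1 * v z ^ k * \<iota> z $ 2"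
        using e[OF z] by (simp add: eq_neg_iff_add_eq_0)
    qed (use s in auto)
    then have *: "d = - 2 * s * c" "i = 0" "j = k" "p = 1" "q = 0" by auto
    then have c0: "c \<noteq> 0" using False by auto
    then have "m = inverse (\<beta> ^ k)" using c * m by (metis inverse_inverse_eq mult_1 power_0)
    moreover have "same_sub a b (m, \<iota>) (m, \<lambda>z. vec2 (v z ^ k) (- 2 * s * u z))"
      by (rule same_subI[of _ c]) (use c0 m * f g in \<open>auto simp: vec_eq_iff forall_2\<close>)
    ultimately show ?thesis by blast
  qed
qed

text \<open>Now the form is f (2 s u g - v^k f): the roles of the two components are exchanged, so
  \<open>monomials_cross\<close> is applied to the second component against the first.\<close>

lemma invariant_subs_lower:
  assumes s: "s \<noteq> 0" and k: "0 < k"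
  shows "invariant_subs_are a b (\<beta> ^ k * inverse \<alpha>, \<lambda>z. mat2 (s * u z) 0 (v z ^ k) (- (s * u z)))
    {(\<beta> ^ k * inverse \<alpha>, \<lambda>z. vec2 0 1), (inverse \<alpha>, \<lambda>z. vec2 (2 * s * u z) (v z ^ k))}"
    (is "invariant_subs_are a b (?h, ?\<phi>) ?S")
proof (rule invariant_subs_areI)
  show "hol2_on (\<lambda>z. ?\<phi> z $ i $ j) (- {0})" for i j
    using exhaust_2[of i] exhaust_2[of j] by (auto simp: hol2_uv)
next
  fix m :: complex and \<iota> :: "complex \<times> complex \<Rightarrow> complex^2"
  assume "(m, \<iota>) \<in> ?S"
  then consider "m = ?h" "\<iota> = (\<lambda>z. vec2 0 1)" |
    "m = inverse \<alpha>" "\<iota> = (\<lambda>z. vec2 (2 * s * u z) (v z ^ k))" by auto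
  then show "m \<noteq> 0 \<and> (\<forall>i. (\<lambda>z. \<iota> z $ i) \<in> H0 a b (inverse m * summand ?h i)) \<and>
      (\<forall>z. z \<noteq> 0 \<longrightarrow> \<iota> z \<noteq> 0) \<and> eigen_inclusion ?\<phi> \<iota>"
  proof cases
    case 1
    have "(\<lambda>z. 1) \<in> H0 a b (inverse ?h * ?h)"
      by (rule H0I[of 1 _ 0 0]) (auto simp: field_simps)
    then show ?thesis using 1
      by (auto simp: forall_2 summand_def vec2_nonzero_iff eigen_inclusion_def intro: H0_zero_const)
  next
    case 2
    have "(\<lambda>z. v z ^ k) \<in> H0 a b (inverse (inverse \<alpha>) * ?h)"
      by (rule H0I[of 1 _ 0 k]) (auto simp: field_simps)
    moreover have "(\<lambda>z. 2 * s * u z) \<in> H0 a b \<alpha>"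
      by (rule H0I[of "2 * s" _ 1 0]) auto
    ultimately show ?thesis using 2 s
      by (auto simp: forall_2 summand_def vec2_nonzero_iff eigen_inclusion_def coords_nonzero_iff algebra_simps)
  qed
next
  fix m :: complex and \<iota> :: "complex \<times> complex \<Rightarrow> complex^2"
  assume m: "m \<noteq> 0" and H: "\<And>i. (\<lambda>z. \<iota> z $ i) \<in> H0 a b (inverse m * summand ?h i)"
    and nonzero: "\<And>z. z \<noteq> 0 \<Longrightarrow> \<iota> z \<noteq> 0" and eig: "eigen_inclusion ?\<phi> \<iota>"
  have e: "\<iota> z $ 1 * (2 * s * u z * \<iota> z $ 2 - v z ^ k * \<iota> z $ 1) = 0" if "z \<noteq> 0" for z
    using eig[unfolded eigen_inclusion_def, rule_format, OF that] by (simp add: algebra_simps)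
  obtain c i j d p q where
    c: "c = 0 \<or> inverse m = \<alpha> ^ i * \<beta> ^ j" and d: "d = 0 \<or> inverse m * ?h = \<alpha> ^ p * \<beta> ^ q"
    and f: "\<And>z. z \<noteq> 0 \<Longrightarrow> \<iota> z $ 1 = c * u z ^ i * v z ^ j"
    and g: "\<And>z. z \<noteq> 0 \<Longrightarrow> \<iota> z $ 2 = d * u z ^ p * v z ^ q"
    and fg: "\<And>z. z \<noteq> 0 \<Longrightarrow> \<iota> z $ 1 \<noteq> 0 \<or> \<iota> z $ 2 \<noteq> 0"
    using sub_cases[of \<iota> m ?h] H nonzero by blast
  show "\<exists>M'\<in>?S. same_sub a b (m, \<iota>) M'"
  proof (cases "c = 0")
    case True
    then have d0: "d \<noteq> 0 \<and> p = 0 \<and> q = 0"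
      using fg f g monomial_nonvanishing[of d p q] by (metis mult_zero_left)
    then have "inverse m * ?h = 1" using d by simp
    then have "m = ?h" using m by (simp add: field_simps)
    moreover have "same_sub a b (m, \<iota>) (m, \<lambda>z. vec2 0 1)"
      by (rule same_subI[of _ d]) (use d0 m True f g in \<open>auto simp: vec_eq_iff forall_2\<close>)
    ultimately show ?thesis by blast
  next
    case False
    have "2 * s * d = 1 * c \<and> p = 0 \<and> q = k \<and> i = 1 \<and> j = 0"
    proof (rule monomials_cross[OF _ _ k g f])
      fix z assume uv: "u z \<noteq> 0" "v z \<noteq> 0"
      then have z: "z \<noteq> 0" by (simp add: coords_nonzero_iff)
      then have "\<iota> z $ 1 \<noteq> 0" using f uv False by simp
      then show "2 * s * u z * \<iota> z $ 2 = 1 * v z ^ k * \<iota> z $ 1"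
        using e[OF z] by simp
    qed (use s fg in auto)
    then have *: "c = 2 * s * d" "p = 0" "q = k" "i = 1" "j = 0" by auto
    then have d0: "d \<noteq> 0" using False by auto
    then have "m = inverse \<alpha>" using c False * m
      by (metis inverse_inverse_eq mult_1_right power_0 power_one_right)
    moreover have "same_sub a b (m, \<iota>) (m, \<lambda>z. vec2 (2 * s * u z) (v z ^ k))"
      by (rule same_subI[of _ d]) (use d0 m * f g in \<open>auto simp: vec_eq_iff forall_2\<close>)
    ultimately show ?thesis by blast
  qed
qed

text \<open>The field is nilpotent and the form degenerates to f^2, so its only zero line is the
  kernel.\<close>

lemma invariant_subs_constant:
  assumes h: "h \<noteq> 0"
  shows "invariant_subs_are a b (h, \<lambda>z. mat2 0 0 1 0) {(h, \<lambda>z. vec2 0 1)}"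
    (is "invariant_subs_are a b (_, ?\<phi>) ?S")
proof (rule invariant_subs_areI)
  show "hol2_on (\<lambda>z. ?\<phi> z $ i $ j) (- {0})" for i j
    using exhaust_2[of i] exhaust_2[of j] by (auto simp: hol2_uv)
next
  fix m :: complex and \<iota> :: "complex \<times> complex \<Rightarrow> complex^2"
  assume "(m, \<iota>) \<in> ?S"
  then show "m \<noteq> 0 \<and> (\<forall>i. (\<lambda>z. \<iota> z $ i) \<in> H0 a b (inverse m * summand h i)) \<and>
      (\<forall>z. z \<noteq> 0 \<longrightarrow> \<iota> z \<noteq> 0) \<and> eigen_inclusion ?\<phi> \<iota>"
    using h by (auto simp: forall_2 summand_def vec2_nonzero_iff eigen_inclusion_def intro: H0_zero_const H0I[of 1 _ 0 0])
next
  fix m :: complex and \<iota> :: "complex \<times> complex \<Rightarrow> complex^2"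
  assume m: "m \<noteq> 0" and H: "\<And>i. (\<lambda>z. \<iota> z $ i) \<in> H0 a b (inverse m * summand h i)"
    and nonzero: "\<And>z. z \<noteq> 0 \<Longrightarrow> \<iota> z \<noteq> 0" and eig: "eigen_inclusion ?\<phi> \<iota>"
  have f: "\<iota> z $ 1 = 0" if "z \<noteq> 0" for z
    using eig[unfolded eigen_inclusion_def, rule_format, OF that] by simp
  then obtain d where d: "d \<noteq> 0" "inverse m * h = 1" "\<And>z. z \<noteq> 0 \<Longrightarrow> \<iota> z $ 2 = d"
    using H0_nowhere_vanishing[OF H[of 2]] nonzero by (auto simp: summand_def vec2_nonzero_iff)
  then have "m = h" using m by (simp add: field_simps)
  moreover have "same_sub a b (m, \<iota>) (m, \<lambda>z. vec2 0 1)"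
    by (rule same_subI[of _ d]) (use d m f in \<open>auto simp: vec_eq_iff forall_2\<close>)
  ultimately show "\<exists>M'\<in>?S. same_sub a b (m, \<iota>) M'" by blast
qed

end

section \<open>Nowhere-vanishing Higgs fields\<close>

lemma mat2_eqI:
  assumes "A $ 1 $ 1 = B $ 1 $ 1" "A $ 1 $ 2 = B $ 1 $ 2" "A $ 2 $ 1 = B $ 2 $ 1" "A $ 2 $ 2 = B $ 2 $ 2"
  shows "A = (B :: complex^2^2)"
  using assms by (simp add: vec_eq_iff forall_2)

lemma matrix_mult_2: "(A ** B) $ i $ j = A $ i $ 1 * B $ 1 $ j + A $ i $ 2 * B $ 2 $ j"
  for A B :: "complex^2^2"
  by (simp add: matrix_matrix_mult_def sum_2)

lemma matrix_inv_inverse: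
  fixes A :: "'a::semiring_1^'n^'n"
  assumes "invertible A"
  shows "A ** matrix_inv A = mat 1 \<and> matrix_inv A ** A = mat 1"
  unfolding matrix_inv_def by (rule someI_ex) (use assms in \<open>auto simp: invertible_def\<close>)

text \<open>As an intertwining relation, conjugacy can be compared entry by entry, without computing
  an inverse matrix.\<close>

lemma conjugate_iff:
  "conjugate a b h \<phi> \<phi>' \<longleftrightarrow> (\<exists>\<Psi>. twisted_end a b 1 h \<Psi> \<and>
    (\<forall>z. z \<noteq> 0 \<longrightarrow> det (\<Psi> z) \<noteq> 0 \<and> \<phi>' z ** \<Psi> z = \<Psi> z ** \<phi> z))"
proof -
  have eq: "B = P ** A ** matrix_inv P \<longleftrightarrow> B ** P = P ** A" if P: "invertible P" for P A B :: "complex^2^2"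
  proof
    assume "B = P ** A ** matrix_inv P"
    then have "B ** P = P ** A ** (matrix_inv P ** P)" by (simp add: matrix_mul_assoc)
    then show "B ** P = P ** A" using matrix_inv_inverse[OF P] by simp
  next
    assume "B ** P = P ** A"
    then have "P ** A ** matrix_inv P = B ** (P ** matrix_inv P)" by (simp add: matrix_mul_assoc)
    then show "B = P ** A ** matrix_inv P" using matrix_inv_inverse[OF P] by simp
  qed
  show ?thesis
    unfolding conjugate_def automorphism_def
    by (rule ex_cong1) (auto simp: eq invertible_det_nz simp del: split_paired_All)
qed

context hopf_coords
begin

lemma ln_b_neg: "ln (cmod b) < 0"
proof -
  have "0 < cmod b" "cmod b < 1" using norms coords by auto
  then show ?thesis by (rule ln_less_zero)
qed

text \<open>The inequality reverses because \<open>ln (cmod b)\<close> is negative.\<close>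

lemma hopf_deg_le_0_iff: "h \<noteq> 0 \<Longrightarrow> hopf_deg b h \<le> 0 \<longleftrightarrow> 1 \<le> cmod h"
  using ln_b_neg unfolding hopf_deg_def by (auto simp: divide_le_0_iff)

lemma hopf_deg_eq_0_iff: "h \<noteq> 0 \<Longrightarrow> hopf_deg b h = 0 \<longleftrightarrow> cmod h = 1"
  using ln_b_neg by (simp add: hopf_deg_def)

text \<open>Automorphisms of this shape carry out all normalizations below. The corner
  \<open>y\<close> is nonzero only for the antidiagonal form, where the inverse of H is the twisting
  bundle and has the section \<open>u\<close>.\<close>

lemma conjugate_upperI:
  assumes "c \<noteq> 0" "d \<noteq> 0" "h \<noteq> 0" "y \<in> H0 a b (inverse h)"
    and "\<And>z. z \<noteq> 0 \<Longrightarrow> \<phi>' z ** mat2 c (y z) 0 d = mat2 c (y z) 0 d ** \<phi> z"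
  shows "conjugate a b h \<phi> \<phi>'"
  unfolding conjugate_iff
proof (intro exI conjI allI impI)
  show "twisted_end a b 1 h (\<lambda>z. mat2 c (y z) 0 d)"
    unfolding twisted_end_def forall_2
    using assms H0_zero_const H0I[of c 1 0 0] H0I[of d 1 0 0]
    by (auto simp: summand_def divide_inverse)
qed (use assms in \<open>auto simp: det_2\<close>)

lemma conjugate_det:
  assumes "conjugate a b h \<phi> \<phi>'" "z \<noteq> 0"
  shows "det (\<phi>' z) = det (\<phi> z)"
proof -
  obtain P :: "complex^2^2" where "det P \<noteq> 0" "\<phi>' z ** P = P ** \<phi> z"
    using assms unfolding conjugate_iff by blast
  then show ?thesis using det_mul[of "\<phi>' z" P] det_mul[of P "\<phi> z"] by simp
qed

text \<open>This fixes the sign that the determinant cannot see. The lower left entry of an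
  automorphism is a section of H and hence zero, so the diagonal is invertible; comparing upper left
  entries at a point where \<phi> is upper triangular gives the equality.\<close>

lemma conjugate_diagonal_eq:
  assumes conj: "conjugate a b h \<phi> \<phi>'" and h: "\<And>i j. h \<noteq> \<alpha> ^ i * \<beta> ^ j" and z: "z \<noteq> 0"
    and diag: "\<phi>' z $ 1 $ 2 = 0" "\<phi> z $ 2 $ 1 = 0"
  shows "\<phi>' z $ 1 $ 1 = \<phi> z $ 1 $ 1"
proof -
  obtain \<Psi> where \<Psi>: "twisted_end a b 1 h \<Psi>" "det (\<Psi> z) \<noteq> 0" "\<phi>' z ** \<Psi> z = \<Psi> z ** \<phi> z"
    using conj z unfolding conjugate_iff by blast
  have "(\<lambda>z. \<Psi> z $ 2 $ 1) \<in> H0 a b h"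
    using \<Psi>(1)[unfolded twisted_end_def, rule_format, of 2 1] by (simp add: summand_def)
  then have "\<Psi> z $ 2 $ 1 = 0" using H0_trivial h z by blast
  then have "\<Psi> z $ 1 $ 1 \<noteq> 0" using \<Psi>(2) by (auto simp: det_2)
  moreover have "(\<phi>' z ** \<Psi> z) $ 1 $ 1 = (\<Psi> z ** \<phi> z) $ 1 $ 1" using \<Psi>(3) by simp
  ultimately show ?thesis using diag by (simp add: matrix_mult_2)
qed

text \<open>Clearing denominators would require \<open>j + k = 0\<close>. Hence this line bundle has
  no nonzero sections, both when it plays the role of H and when it is the twist.\<close>

lemma multiplier_upper_not_monomial: "0 < k \<Longrightarrow> \<alpha> * inverse (\<beta> ^ k) \<noteq> \<alpha> ^ i * \<beta> ^ j"
  using monomial_eq_iff[of 1 0 i "j + k"] by (auto simp: field_simps power_add)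

lemma multiplier_lower_not_monomial: "\<beta> ^ k * inverse \<alpha> \<noteq> \<alpha> ^ i * \<beta> ^ j"
  using monomial_eq_iff[of 0 k "Suc i" j] by (auto simp: field_simps)

lemma multiplier_upper_eq_iff: "\<alpha> * inverse (\<beta> ^ k) = \<alpha> * inverse (\<beta> ^ k') \<longleftrightarrow> k = k'"
  using monomial_eq_iff[of 0 k 0 k'] by auto

lemma multiplier_lower_eq_iff: "\<beta> ^ k * inverse \<alpha> = \<beta> ^ k' * inverse \<alpha> \<longleftrightarrow> k = k'"
  using monomial_eq_iff[of 0 k 0 k'] by auto

text \<open>Equality would give \<open>\<alpha> ^ 2 = \<beta> ^ (k + k')\<close>. So the two
  triangular families never share an H and can meet only through renormalization.\<close>

lemma multiplier_upper_neq_lower: "\<alpha> * inverse (\<beta> ^ k) \<noteq> \<beta> ^ k' * inverse \<alpha>"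
  using monomial_eq_iff[of 2 0 0 "k + k'"] by (auto simp: field_simps power_add power2_eq_square)

text \<open>Here and below the degree condition becomes a comparison of moduli. The conditions for
  the upper and lower families overlap exactly when both multipliers have modulus 1.\<close>

lemma cmod_upper_ge_1: "1 \<le> cmod (\<alpha> * inverse (\<beta> ^ k)) \<longleftrightarrow> cmod \<beta> ^ k \<le> cmod \<alpha>"
  by (simp add: norm_mult norm_divide norm_inverse norm_power field_simps norms)

lemma cmod_upper_eq_1: "cmod (\<alpha> * inverse (\<beta> ^ k)) = 1 \<longleftrightarrow> cmod \<beta> ^ k = cmod \<alpha>"
  by (auto simp add: norm_mult norm_divide norm_inverse norm_power field_simps norms)

lemma cmod_lower_ge_1: "1 \<le> cmod (\<beta> ^ k * inverse \<alpha>) \<longleftrightarrow> cmod \<alpha> \<le> cmod \<beta> ^ k"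
  by (simp add: norm_mult norm_divide norm_inverse norm_power field_simps norms)

lemma cmod_lower_eq_1: "cmod (\<beta> ^ k * inverse \<alpha>) = 1 \<longleftrightarrow> cmod \<beta> ^ k = cmod \<alpha>"
  by (auto simp add: norm_mult norm_divide norm_inverse norm_power field_simps norms)

section \<open>Normal forms and the case distinction for coordinate twists\<close>

lemma nv_higgs_bundleI:
  assumes "h \<noteq> 0" "1 \<le> cmod h" "p \<in> H0 a b \<kappa>" "(\<lambda>z. - p z) \<in> H0 a b \<kappa>"
    "q \<in> H0 a b (\<kappa> * inverse h)" "w \<in> H0 a b (\<kappa> * h)"
    and "\<And>z. z \<noteq> 0 \<Longrightarrow> p z \<noteq> 0 \<or> q z \<noteq> 0 \<or> w z \<noteq> 0"
  shows "nv_higgs_bundle a b \<kappa> (h, \<lambda>z. mat2 (p z) (q z) (w z) (- p z))"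
proof -
  have "twisted_end a b \<kappa> h (\<lambda>z. mat2 (p z) (q z) (w z) (- p z))"
    unfolding twisted_end_def forall_2 using assms by (simp add: summand_def divide_inverse mult.assoc)
  moreover have "mat2 (p z) (q z) (w z) (- p z) \<noteq> 0" if "z \<noteq> 0" for z
    using assms(7)[OF that] by (auto simp: vec_eq_iff forall_2)
  ultimately show ?thesis using assms(1,2)
    by (auto simp: nv_higgs_bundle_def higgs_field_def nowhere_vanishing_def hopf_deg_le_0_iff trace_def sum_2
        simp del: split_paired_All)
qed

lemma nv_higgs_bundleD:
  assumes "nv_higgs_bundle a b \<kappa> (h, \<phi>)"
  obtains p q w where "h \<noteq> 0" "1 \<le> cmod h" "p \<in> H0 a b \<kappa>"
    "q \<in> H0 a b (\<kappa> * inverse h)" "w \<in> H0 a b (\<kappa> * h)"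
    "\<And>z. z \<noteq> 0 \<Longrightarrow> \<phi> z = mat2 (p z) (q z) (w z) (- p z)"
    "\<And>z. z \<noteq> 0 \<Longrightarrow> p z \<noteq> 0 \<or> q z \<noteq> 0 \<or> w z \<noteq> 0"
proof
  have h: "h \<noteq> 0" "hopf_deg b h \<le> 0" and tw: "twisted_end a b \<kappa> h \<phi>"
    and tr: "\<And>z. z \<noteq> 0 \<Longrightarrow> trace (\<phi> z) = 0" and nv: "\<And>z. z \<noteq> 0 \<Longrightarrow> \<phi> z \<noteq> 0"
    using assms by (auto simp: nv_higgs_bundle_def higgs_field_def nowhere_vanishing_def)
  show "h \<noteq> 0" "1 \<le> cmod h" using h hopf_deg_le_0_iff by auto
  show "(\<lambda>z. \<phi> z $ 1 $ 1) \<in> H0 a b \<kappa>" "(\<lambda>z. \<phi> z $ 1 $ 2) \<in> H0 a b (\<kappa> * inverse h)"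
    "(\<lambda>z. \<phi> z $ 2 $ 1) \<in> H0 a b (\<kappa> * h)"
    using tw unfolding twisted_end_def forall_2 by (auto simp: summand_def divide_inverse)
  show eq: "\<phi> z = mat2 (\<phi> z $ 1 $ 1) (\<phi> z $ 1 $ 2) (\<phi> z $ 2 $ 1) (- (\<phi> z $ 1 $ 1))" if "z \<noteq> 0" for z
  proof (rule mat2_eqI)
    show "\<phi> z $ 2 $ 2 = mat2 (\<phi> z $ 1 $ 1) (\<phi> z $ 1 $ 2) (\<phi> z $ 2 $ 1) (- (\<phi> z $ 1 $ 1)) $ 2 $ 2"
      using tr[OF that] by (simp add: trace_def sum_2 eq_neg_iff_add_eq_0 add.commute)
  qed simp_all
  show "\<phi> z $ 1 $ 1 \<noteq> 0 \<or> \<phi> z $ 1 $ 2 \<noteq> 0 \<or> \<phi> z $ 2 $ 1 \<noteq> 0" if "z \<noteq> 0" for z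
  proof (rule ccontr)
    assume "\<not> ?thesis"
    then have "\<phi> z = 0" using tr[OF that]
      by (intro mat2_eqI) (auto simp: trace_def sum_2)
    then show False using nv[OF that] by simp
  qed
qed

abbreviation "antidiag_form t \<equiv> (\<lambda>z. mat2 0 (t * (u z)\<^sup>2) 1 0)"
abbreviation "upper_form s k \<equiv> (\<lambda>z. mat2 (s * u z) (v z ^ k) 0 (- (s * u z)))"
abbreviation "lower_form s k \<equiv> (\<lambda>z. mat2 (s * u z) 0 (v z ^ k) (- (s * u z)))"

lemma nv_antidiag_form: "nv_higgs_bundle a b \<alpha> (inverse \<alpha>, antidiag_form t)"
proof -
  have "(\<lambda>z. t * (u z)\<^sup>2) \<in> H0 a b (\<alpha> * inverse (inverse \<alpha>))"
    by (rule H0I[of t _ 2 0]) (auto simp: power2_eq_square)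
  moreover have "(\<lambda>z. 1) \<in> H0 a b (\<alpha> * inverse \<alpha>)"
    by (rule H0I[of 1 _ 0 0]) auto
  ultimately show ?thesis
    using nv_higgs_bundleI[of "inverse \<alpha>" "\<lambda>z. 0" \<alpha> "\<lambda>z. t * (u z)\<^sup>2" "\<lambda>z. 1"] H0_zero_const norms
    by (simp add: norm_inverse one_le_inverse)
qed

lemma H0_linear: "(\<lambda>z. s * u z) \<in> H0 a b \<alpha>" "(\<lambda>z. - (s * u z)) \<in> H0 a b \<alpha>"
  by (rule H0I[of s _ 1 0]; simp) (rule H0I[of "- s" _ 1 0]; simp)

lemma nv_upper_form:
  assumes "s \<noteq> 0" "cmod \<beta> ^ k \<le> cmod \<alpha>"
  shows "nv_higgs_bundle a b \<alpha> (\<alpha> * inverse (\<beta> ^ k), upper_form s k)"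
proof -
  have "(\<lambda>z. v z ^ k) \<in> H0 a b (\<alpha> * inverse (\<alpha> * inverse (\<beta> ^ k)))"
    by (rule H0I[of 1 _ 0 k]) (auto simp: field_simps)
  then show ?thesis
    using nv_higgs_bundleI[of "\<alpha> * inverse (\<beta> ^ k)" "\<lambda>z. s * u z" \<alpha> "\<lambda>z. v z ^ k" "\<lambda>z. 0"]
      H0_zero_const H0_linear assms cmod_upper_ge_1 coords_nonzero_iff by auto
qed

lemma nv_lower_form:
  assumes "s \<noteq> 0" "cmod \<alpha> \<le> cmod \<beta> ^ k"
  shows "nv_higgs_bundle a b \<alpha> (\<beta> ^ k * inverse \<alpha>, lower_form s k)"
proof -
  have "(\<lambda>z. v z ^ k) \<in> H0 a b (\<alpha> * (\<beta> ^ k * inverse \<alpha>))"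
    by (rule H0I[of 1 _ 0 k]) (auto simp: field_simps)
  then show ?thesis
    using nv_higgs_bundleI[of "\<beta> ^ k * inverse \<alpha>" "\<lambda>z. s * u z" \<alpha> "\<lambda>z. 0" "\<lambda>z. v z ^ k"]
      H0_zero_const H0_linear assms cmod_lower_ge_1 coords_nonzero_iff by auto
qed

text \<open>Once H is known, the opposite off-diagonal entry would be a section of multiplier
  \<open>\<alpha> ^ 2 * inverse (\<beta> ^ k)\<close>, which is zero for positive k. On the axis v =
  0 only the diagonal then remains, so s is nonzero. For k = 0 a nonzero constant in the lower left
  corner already prevents zeros, and s is unrestricted.\<close>

lemma nv_linear_cases:
  assumes "nv_higgs_bundle a b \<alpha> (h, \<phi>)"
  obtains
    (upper) s c k where "s \<noteq> 0" "c \<noteq> 0" "0 < k" "h = \<alpha> * inverse (\<beta> ^ k)" "cmod \<beta> ^ k \<le> cmod \<alpha>"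
      "\<And>z. z \<noteq> 0 \<Longrightarrow> \<phi> z = mat2 (s * u z) (c * v z ^ k) 0 (- (s * u z))"
  | (antidiag) s t c where "c \<noteq> 0" "h = inverse \<alpha>"
      "\<And>z. z \<noteq> 0 \<Longrightarrow> \<phi> z = mat2 (s * u z) (t * (u z)\<^sup>2) c (- (s * u z))"
  | (lower) s c k where "s \<noteq> 0" "c \<noteq> 0" "0 < k" "h = \<beta> ^ k * inverse \<alpha>" "cmod \<alpha> \<le> cmod \<beta> ^ k"
      "\<And>z. z \<noteq> 0 \<Longrightarrow> \<phi> z = mat2 (s * u z) 0 (c * v z ^ k) (- (s * u z))"
proof -
  obtain p q w where h: "h \<noteq> 0" "1 \<le> cmod h" and p: "p \<in> H0 a b \<alpha>"
    and q: "q \<in> H0 a b (\<alpha> * inverse h)" and w: "w \<in> H0 a b (\<alpha> * h)"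
    and \<phi>: "\<And>z. z \<noteq> 0 \<Longrightarrow> \<phi> z = mat2 (p z) (q z) (w z) (- p z)"
    and nv: "\<And>z. z \<noteq> 0 \<Longrightarrow> p z \<noteq> 0 \<or> q z \<noteq> 0 \<or> w z \<noteq> 0"
    using nv_higgs_bundleD[OF assms] by blast
  have "\<alpha> = \<alpha> ^ 1 * \<beta> ^ 0" by simp
  from H0_monomial[OF p this] obtain s where "\<And>z. z \<noteq> 0 \<Longrightarrow> p z = s * u z ^ 1 * v z ^ 0" by blast
  then have s: "p z = s * u z" if "z \<noteq> 0" for z using that by simp
  \<comment> \<open>\<open>z1\<close> lies on the axis where the diagonal vanishes,
    \<open>z2\<close> on the axis where positive powers of \<open>v\<close> vanish.\<close>
  obtain z1 where z1: "z1 \<noteq> 0" "u z1 = 0" "v z1 = 1" using point[of 0 1] by auto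
  obtain z2 where z2: "z2 \<noteq> 0" "u z2 = 1" "v z2 = 0" using point[of 1 0] by auto
  have "q z1 \<noteq> 0 \<or> w z1 \<noteq> 0" using nv[OF z1(1)] s[OF z1(1)] z1 by simp
  then show thesis
  proof
    assume q1: "q z1 \<noteq> 0"
    obtain c i k where c: "c = 0 \<or> \<alpha> * inverse h = \<alpha> ^ i * \<beta> ^ k"
      "\<And>z. z \<noteq> 0 \<Longrightarrow> q z = c * u z ^ i * v z ^ k"
      using H0_cases[OF q] by blast
    have "i = 0" "c \<noteq> 0" using q1 c(2)[OF z1(1)] z1 by (auto simp: zero_power split: if_splits)
    then have hk: "h = \<alpha> * inverse (\<beta> ^ k)" using c(1) h by (auto simp: field_simps)
    then have le: "cmod \<beta> ^ k \<le> cmod \<alpha>" using h cmod_upper_ge_1 by simp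
    \<comment> \<open>The exponent 0 would give \<open>cmod \<alpha> \<ge> 1\<close>.\<close>
    then have k: "0 < k" using norms by (cases k) auto
    have w0: "w z = 0" if "z \<noteq> 0" for z
    proof (rule H0_trivial[OF w _ that])
      show "\<alpha> * h \<noteq> \<alpha> ^ i * \<beta> ^ j" for i j
        using monomial_eq_iff[of 2 0 i "j + k"] k hk
        by (auto simp: field_simps power_add power2_eq_square)
    qed
    have "s \<noteq> 0" using nv[OF z2(1)] s[OF z2(1)] w0[OF z2(1)] c(2)[OF z2(1)] z2 k by auto
    then show thesis
      by (rule upper[of s c k, OF _ \<open>c \<noteq> 0\<close> k hk le])
        (use \<phi> s w0 c(2) \<open>i = 0\<close> in auto)
  next
    assume w1: "w z1 \<noteq> 0"
    obtain c i k where c: "c = 0 \<or> \<alpha> * h = \<alpha> ^ i * \<beta> ^ k"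
      "\<And>z. z \<noteq> 0 \<Longrightarrow> w z = c * u z ^ i * v z ^ k"
      using H0_cases[OF w] by blast
    have "i = 0" "c \<noteq> 0" using w1 c(2)[OF z1(1)] z1 by (auto simp: zero_power split: if_splits)
    then have hk: "h = \<beta> ^ k * inverse \<alpha>" using c(1) h by (auto simp: field_simps)
    show thesis
    proof (cases "k = 0")
      case True
      have "\<alpha> * inverse h = \<alpha> ^ 2 * \<beta> ^ 0" using hk True by (simp add: power2_eq_square)
      from H0_monomial[OF q this] obtain t where "\<And>z. z \<noteq> 0 \<Longrightarrow> q z = t * u z ^ 2 * v z ^ 0"
        by blast
      then show thesis
        by (intro antidiag[of c s t]) (use \<phi> s c(2) \<open>i = 0\<close> \<open>c \<noteq> 0\<close> hk True in auto)
    next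
      case False
      then have k: "0 < k" by simp
      have le: "cmod \<alpha> \<le> cmod \<beta> ^ k" using h hk cmod_lower_ge_1 by simp
      have q0: "q z = 0" if "z \<noteq> 0" for z
      proof (rule H0_trivial[OF q _ that])
        show "\<alpha> * inverse h \<noteq> \<alpha> ^ i * \<beta> ^ j" for i j
          unfolding hk using monomial_eq_iff[of 2 0 i "j + k"] k
          by (auto simp: field_simps power_add power2_eq_square)
      qed
      have "s \<noteq> 0" using nv[OF z2(1)] s[OF z2(1)] q0[OF z2(1)] c(2)[OF z2(1)] z2 k by auto
      then show thesis
        by (rule lower[of s c k, OF _ \<open>c \<noteq> 0\<close> k hk le])
          (use \<phi> s q0 c(2) \<open>i = 0\<close> in auto)
    qed
  qed
qed

section \<open>Reduction to normal forms and uniqueness of parameters\<close>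

lemma higgs_equiv_iff: "h \<noteq> 0 \<Longrightarrow> higgs_equiv a b (h, \<phi>) (h', \<phi>') \<longleftrightarrow>
    h' = h \<and> conjugate a b h \<phi> \<phi>' \<or>
    cmod h = 1 \<and> h' = inverse h \<and> conjugate a b h' (renormalize \<phi>) \<phi>'"
  by (auto simp: higgs_equiv_def hopf_deg_eq_0_iff)

lemma conjugate_upper_form:
  assumes "c \<noteq> 0" "h \<noteq> 0" "\<And>z. z \<noteq> 0 \<Longrightarrow> \<phi> z = mat2 (s * u z) (c * v z ^ k) 0 (- (s * u z))"
  shows "conjugate a b h \<phi> (upper_form s k)"
proof (rule conjugate_upperI[of 1 c _ "\<lambda>z. 0"])
  show "upper_form s k z ** mat2 1 0 0 c = mat2 1 0 0 c ** \<phi> z" if "z \<noteq> 0" for z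
    by (rule mat2_eqI) (simp_all add: matrix_mult_2 assms(3)[OF that])
qed (use assms H0_zero_const in auto)

lemma conjugate_lower_form:
  assumes "c \<noteq> 0" "h \<noteq> 0" "\<And>z. z \<noteq> 0 \<Longrightarrow> \<phi> z = mat2 (s * u z) 0 (c * v z ^ k) (- (s * u z))"
  shows "conjugate a b h \<phi> (lower_form s k)"
proof (rule conjugate_upperI[of c 1 _ "\<lambda>z. 0"])
  show "lower_form s k z ** mat2 c 0 0 1 = mat2 c 0 0 1 ** \<phi> z" if "z \<noteq> 0" for z
    by (rule mat2_eqI) (simp_all add: matrix_mult_2 assms(3)[OF that])
qed (use assms H0_zero_const in auto)

text \<open>A shear by \<open>- (s * u z)\<close> clears the diagonal. The parameter
  \<open>c * t + s\<^sup>2\<close> is forced: times u^2 it is minus the determinant.\<close>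

lemma conjugate_antidiag_form:
  assumes "c \<noteq> 0" "\<And>z. z \<noteq> 0 \<Longrightarrow> \<phi> z = mat2 (s * u z) (t * (u z)\<^sup>2) c (- (s * u z))"
  shows "conjugate a b (inverse \<alpha>) \<phi> (antidiag_form (c * t + s\<^sup>2))"
proof (rule conjugate_upperI[of c 1 _ "\<lambda>z. - (s * u z)"])
  show "antidiag_form (c * t + s\<^sup>2) z ** mat2 c (- (s * u z)) 0 1 = mat2 c (- (s * u z)) 0 1 ** \<phi> z"
    if "z \<noteq> 0" for z
    by (rule mat2_eqI) (simp_all add: matrix_mult_2 assms(2)[OF that] algebra_simps power2_eq_square)
qed (use assms H0_linear in auto)

text \<open>The off-diagonal powers of \<open>v\<close> disappear on the axis v = 0, so the diagonal
  entries can be compared at (1, 0).\<close>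

lemma diagonal_entry_unique:
  assumes conj: "conjugate a b h \<phi> \<phi>'" and h: "\<And>i j. h \<noteq> \<alpha> ^ i * \<beta> ^ j"
    and \<phi>: "\<And>z. z \<noteq> 0 \<Longrightarrow> v z = 0 \<Longrightarrow> \<phi> z $ 1 $ 1 = s * u z \<and> \<phi> z $ 2 $ 1 = 0"
    and \<phi>': "\<And>z. z \<noteq> 0 \<Longrightarrow> v z = 0 \<Longrightarrow> \<phi>' z $ 1 $ 1 = s' * u z \<and> \<phi>' z $ 1 $ 2 = 0"
  shows "s' = s"
proof -
  obtain z where z: "z \<noteq> 0" "u z = 1" "v z = 0" using point[of 1 0] by auto
  have "\<phi>' z $ 1 $ 1 = \<phi> z $ 1 $ 1"
    by (rule conjugate_diagonal_eq[OF conj h z(1)]) (use \<phi> \<phi>' z in auto)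
  then show ?thesis using \<phi>[OF z(1,3)] \<phi>'[OF z(1,3)] z by simp
qed

text \<open>When \<open>cmod \<beta> ^ k = cmod \<alpha>\<close>, the upper and lower multipliers
  are inverse to each other and of degree 0. The list keeps the upper form, and a lower field is
  sent there by renormalization; this is why the lower inequality is strict. Positivity of k in the
  upper family follows from its inequality.\<close>

theorem classified_linear:
  "nv_higgs_classified_by a b \<alpha>
    ({(inverse \<alpha>, antidiag_form t) | t. True} \<union>
     {(\<alpha> * inverse (\<beta> ^ k), upper_form s k) | s k. s \<noteq> 0 \<and> cmod \<beta> ^ k \<le> cmod \<alpha>} \<union>
     {(\<beta> ^ k * inverse \<alpha>, lower_form s k) | s k. s \<noteq> 0 \<and> 0 < k \<and> cmod \<alpha> < cmod \<beta> ^ k})"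
  (is "nv_higgs_classified_by a b \<alpha> ?S")
  unfolding nv_higgs_classified_by_def
proof (intro conjI ballI allI impI)
  fix E assume "E \<in> ?S"
  then show "nv_higgs_bundle a b \<alpha> E"
    using nv_antidiag_form nv_upper_form nv_lower_form by auto
next
  fix E assume nv: "nv_higgs_bundle a b \<alpha> E"
  obtain h \<phi> where E: "E = (h, \<phi>)" by (cases E)
  have S_cases: thesis if "(h', \<phi>') \<in> ?S"
    "\<And>t. h' = inverse \<alpha> \<Longrightarrow> \<phi>' = antidiag_form t \<Longrightarrow> thesis"
    "\<And>s k. h' = \<alpha> * inverse (\<beta> ^ k) \<Longrightarrow> \<phi>' = upper_form s k \<Longrightarrow> s \<noteq> 0 \<Longrightarrow> cmod \<beta> ^ k \<le> cmod \<alpha> \<Longrightarrow> thesis"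
    "\<And>s k. h' = \<beta> ^ k * inverse \<alpha> \<Longrightarrow> \<phi>' = lower_form s k \<Longrightarrow> s \<noteq> 0 \<Longrightarrow> 0 < k \<Longrightarrow>
      cmod \<alpha> < cmod \<beta> ^ k \<Longrightarrow> thesis" for h' \<phi>' thesis
    using that(1) by (elim UnE CollectE exE conjE Pair_inject) (rule that(2-4); assumption)+
  have neq: "\<alpha> * inverse (\<beta> ^ k) \<noteq> inverse \<alpha>" "inverse \<alpha> \<noteq> \<alpha> * inverse (\<beta> ^ k)"
    "0 < k \<Longrightarrow> \<beta> ^ k * inverse \<alpha> \<noteq> inverse \<alpha>" "0 < k \<Longrightarrow> inverse \<alpha> \<noteq> \<beta> ^ k * inverse \<alpha>" for k
    using multiplier_upper_neq_lower[of k 0] multiplier_lower_eq_iff[of k 0] by auto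
  have nz: "\<alpha> * inverse (\<beta> ^ k) \<noteq> 0" "\<beta> ^ k * inverse \<alpha> \<noteq> 0" for k by simp_all
  have inv: "inverse (\<alpha> * inverse (\<beta> ^ k)) = \<beta> ^ k * inverse \<alpha>"
    "inverse (\<beta> ^ k * inverse \<alpha>) = \<alpha> * inverse (\<beta> ^ k)" for k by simp_all
  have "\<exists>!E'. E' \<in> ?S \<and> higgs_equiv a b (h, \<phi>) E'"
    using nv[unfolded E]
  proof (cases rule: nv_linear_cases)
    case (upper s c k)
    note \<phi> = upper(6)
    show ?thesis
    proof (rule ex1I[of _ "(h, upper_form s k)"])
      show "(h, upper_form s k) \<in> ?S \<and> higgs_equiv a b (h, \<phi>) (h, upper_form s k)"
        using upper conjugate_upper_form[of c h \<phi> s k] nz[of k] by (auto simp: higgs_equiv_iff)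
      fix E' assume E': "E' \<in> ?S \<and> higgs_equiv a b (h, \<phi>) E'"
      obtain h' \<phi>' where E'_eq: "E' = (h', \<phi>')" by (cases E')
      from E' E'_eq have in_S: "(h', \<phi>') \<in> ?S" by simp
      have "h' = h \<and> conjugate a b h \<phi> \<phi>' \<or> cmod h = 1 \<and> h' = \<beta> ^ k * inverse \<alpha>"
      proof -
        have "h \<noteq> 0" "inverse h = \<beta> ^ k * inverse \<alpha>" using upper(4) nz[of k] inv by auto
        moreover have "higgs_equiv a b (h, \<phi>) (h', \<phi>')" using E' E'_eq by simp
        ultimately show ?thesis using higgs_equiv_iff[of h \<phi> h' \<phi>'] by metis
      qed
      then show "E' = (h, upper_form s k)"
      proof
        assume eq: "h' = h \<and> conjugate a b h \<phi> \<phi>'"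
        show ?thesis
        proof (rule S_cases[OF in_S])
          fix s' k'
          assume h': "h' = \<alpha> * inverse (\<beta> ^ k')" and \<phi>': "\<phi>' = upper_form s' k'"
          have "k' = k" using eq h' upper(4) multiplier_upper_eq_iff by metis
          moreover have "s' = s"
            by (rule diagonal_entry_unique[of h \<phi> \<phi>'])
              (use eq upper(3,4) multiplier_upper_not_monomial \<phi> \<phi>' \<open>k' = k\<close> in auto)
          ultimately show ?thesis using E'_eq eq \<phi>' by simp
        qed (use eq upper(4) neq multiplier_upper_neq_lower in metis)+
      next
        \<comment> \<open>Renormalization would land on a lower multiplier with equal moduli, which
          the strict inequality excludes from the list.\<close>
        assume eq: "cmod h = 1 \<and> h' = \<beta> ^ k * inverse \<alpha>"
        then have "cmod \<beta> ^ k = cmod \<alpha>" using upper(4) cmod_upper_eq_1 by simp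
        with eq upper(3) neq multiplier_upper_neq_lower multiplier_lower_eq_iff have False
          by - (rule S_cases[OF in_S], (metis less_irrefl)+)
        then show ?thesis ..
      qed
    qed
  next
    case (antidiag s t c)
    note \<phi> = antidiag(3)
    have h1: "cmod h \<noteq> 1" using antidiag(2) norms by (simp add: norm_inverse)
    show ?thesis
    proof (rule ex1I[of _ "(h, antidiag_form (c * t + s\<^sup>2))"])
      show "(h, antidiag_form (c * t + s\<^sup>2)) \<in> ?S \<and> higgs_equiv a b (h, \<phi>) (h, antidiag_form (c * t + s\<^sup>2))"
        using antidiag conjugate_antidiag_form[of c \<phi> s t] by (auto simp: higgs_equiv_iff)
      fix E' assume E': "E' \<in> ?S \<and> higgs_equiv a b (h, \<phi>) E'"
      obtain h' \<phi>' where E'_eq: "E' = (h', \<phi>')" by (cases E')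
      from E' E'_eq have in_S: "(h', \<phi>') \<in> ?S" by simp
      have eq: "h' = h \<and> conjugate a b h \<phi> \<phi>'"
        using E' E'_eq higgs_equiv_iff[of h \<phi> h' \<phi>'] antidiag(2) h1 by auto
      show "E' = (h, antidiag_form (c * t + s\<^sup>2))"
      proof (rule S_cases[OF in_S])
        fix t' assume \<phi>': "\<phi>' = antidiag_form t'"
        obtain z where z: "z \<noteq> 0" "u z = 1" "v z = 0" using point[of 1 0] by auto
        \<comment> \<open>The determinant at (1, 0) is minus the parameter of the antidiagonal
          form.\<close>
        have "det (\<phi>' z) = det (\<phi> z)" using eq conjugate_det z(1) by blast
        then have "t' = c * t + s\<^sup>2"
          using \<phi>[OF z(1)] z \<phi>' by (simp add: det_2 power2_eq_square algebra_simps)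
        then show ?thesis using E'_eq eq \<phi>' by simp
      qed (use eq antidiag(2) neq in metis)+
    qed
  next
    case (lower s c k)
    note \<phi> = lower(6)
    show ?thesis
    proof (cases "cmod \<alpha> < cmod \<beta> ^ k")
      case True
      then have h1: "cmod h \<noteq> 1" using lower(4) cmod_lower_eq_1 by simp
      show ?thesis
      proof (rule ex1I[of _ "(h, lower_form s k)"])
        show "(h, lower_form s k) \<in> ?S \<and> higgs_equiv a b (h, \<phi>) (h, lower_form s k)"
          using lower True conjugate_lower_form[of c h \<phi> s k] nz[of k] by (auto simp: higgs_equiv_iff)
        fix E' assume E': "E' \<in> ?S \<and> higgs_equiv a b (h, \<phi>) E'"
        obtain h' \<phi>' where E'_eq: "E' = (h', \<phi>')" by (cases E')
        from E' E'_eq have in_S: "(h', \<phi>') \<in> ?S" by simp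
        have eq: "h' = h \<and> conjugate a b h \<phi> \<phi>'"
          using E' E'_eq higgs_equiv_iff[of h \<phi> h' \<phi>'] lower(4) h1 nz[of k] by auto
        show "E' = (h, lower_form s k)"
        proof (rule S_cases[OF in_S])
          fix s' k'
          assume h': "h' = \<beta> ^ k' * inverse \<alpha>" and \<phi>': "\<phi>' = lower_form s' k'"
          have "k' = k" using eq h' lower(4) multiplier_lower_eq_iff by metis
          moreover have "s' = s"
            by (rule diagonal_entry_unique[of h \<phi> \<phi>'])
              (use eq lower(3,4) multiplier_lower_not_monomial \<phi> \<phi>' \<open>k' = k\<close> in auto)
          ultimately show ?thesis using E'_eq eq \<phi>' by simp
        qed (use eq lower(3,4) neq multiplier_upper_neq_lower in metis)+
      qed
    next
      \<comment> \<open>The boundary case of equal moduli, where the lower form itself is not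
        listed.\<close>
      case False
      then have k: "cmod \<beta> ^ k = cmod \<alpha>" using lower(5) by simp
      then have h1: "cmod h = 1" using lower(4) cmod_lower_eq_1 by simp
      have h_inv: "inverse h = \<alpha> * inverse (\<beta> ^ k)" using lower(4) by simp
      \<comment> \<open>Exchanging the summands swaps the diagonal entries, hence the parameter
        \<open>- s\<close>.\<close>
      have ren: "renormalize \<phi> z = mat2 (- s * u z) (c * v z ^ k) 0 (- (- s * u z))" if "z \<noteq> 0" for z
        by (simp add: renormalize_def \<phi>[OF that])
      show ?thesis
      proof (rule ex1I[of _ "(inverse h, upper_form (- s) k)"])
        show "(inverse h, upper_form (- s) k) \<in> ?S \<and> higgs_equiv a b (h, \<phi>) (inverse h, upper_form (- s) k)"
        proof
          have "- s \<noteq> 0 \<and> cmod \<beta> ^ k \<le> cmod \<alpha>" using lower(1) k by simp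
          then show "(inverse h, upper_form (- s) k) \<in> ?S" using h_inv by blast
          have "conjugate a b (inverse h) (renormalize \<phi>) (upper_form (- s) k)"
            by (rule conjugate_upper_form[OF lower(2) _ ren]) (use h_inv nz in auto)
          then show "higgs_equiv a b (h, \<phi>) (inverse h, upper_form (- s) k)"
            using higgs_equiv_iff lower(4) nz h1 by simp
        qed
        fix E' assume E': "E' \<in> ?S \<and> higgs_equiv a b (h, \<phi>) E'"
        obtain h' \<phi>' where E'_eq: "E' = (h', \<phi>')" by (cases E')
        from E' E'_eq have in_S: "(h', \<phi>') \<in> ?S" by simp
        have "h' = h \<or> h' = inverse h \<and> conjugate a b h' (renormalize \<phi>) \<phi>'"
          using E' E'_eq higgs_equiv_iff[of h \<phi> h' \<phi>'] lower(4) nz[of k] by auto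
        then show "E' = (inverse h, upper_form (- s) k)"
        proof
          assume "h' = h"
          with lower(3,4) k neq multiplier_upper_neq_lower multiplier_lower_eq_iff have False
            by - (rule S_cases[OF in_S], (metis less_irrefl)+)
          then show ?thesis ..
        next
          assume eq: "h' = inverse h \<and> conjugate a b h' (renormalize \<phi>) \<phi>'"
          show ?thesis
          proof (rule S_cases[OF in_S])
            fix s' k'
            assume h': "h' = \<alpha> * inverse (\<beta> ^ k')" and \<phi>': "\<phi>' = upper_form s' k'"
            have "k' = k" using eq h' h_inv multiplier_upper_eq_iff by metis
            moreover have "s' = - s"
              by (rule diagonal_entry_unique[of h' "renormalize \<phi>" \<phi>'])
                (use eq h_inv lower(3) multiplier_upper_not_monomial ren \<phi>' \<open>k' = k\<close> in auto)
            ultimately show ?thesis using E'_eq eq \<phi>' by simp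
          qed (use eq h_inv neq multiplier_upper_neq_lower in metis)+
        qed
      qed
    qed
  qed
  then show "\<exists>!E'. E' \<in> ?S \<and> higgs_equiv a b E E'" by (simp only: E)
qed

text \<open>The twist has no sections, so the diagonal vanishes and one off-diagonal entry alone
  must be nowhere zero, hence constant. A constant upper right entry would make H equal to the
  twist, which has positive degree; a constant lower left entry makes H its inverse.\<close>

theorem classified_constant:
  assumes l: "0 < l" and le: "cmod \<alpha> < cmod \<beta> ^ l"
  shows "nv_higgs_classified_by a b (\<alpha> * inverse (\<beta> ^ l)) {(\<beta> ^ l * inverse \<alpha>, \<lambda>z. mat2 0 0 1 0)}"
  unfolding nv_higgs_classified_by_def
proof (intro conjI ballI allI impI)
  let ?\<kappa> = "\<alpha> * inverse (\<beta> ^ l)"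
  let ?h = "\<beta> ^ l * inverse \<alpha>"
  have "(\<lambda>z. 1) \<in> H0 a b (?\<kappa> * ?h)" by (rule H0I[of 1 _ 0 0]) (auto simp: field_simps)
  then have "nv_higgs_bundle a b ?\<kappa> (?h, \<lambda>z. mat2 0 0 1 0)"
    using nv_higgs_bundleI[of ?h "\<lambda>z. 0" ?\<kappa> "\<lambda>z. 0" "\<lambda>z. 1"] H0_zero_const le cmod_lower_ge_1[of l] by simp
  then show "nv_higgs_bundle a b ?\<kappa> E" if "E \<in> {(?h, \<lambda>z. mat2 0 0 1 0)}" for E
    using that by simp
  fix E assume nv: "nv_higgs_bundle a b ?\<kappa> E"
  obtain h \<phi> where E: "E = (h, \<phi>)" by (cases E)
  obtain p q w where h: "h \<noteq> 0" "1 \<le> cmod h" and p: "p \<in> H0 a b ?\<kappa>"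
    and q: "q \<in> H0 a b (?\<kappa> * inverse h)" and w: "w \<in> H0 a b (?\<kappa> * h)"
    and \<phi>: "\<And>z. z \<noteq> 0 \<Longrightarrow> \<phi> z = mat2 (p z) (q z) (w z) (- p z)"
    and pqw: "\<And>z. z \<noteq> 0 \<Longrightarrow> p z \<noteq> 0 \<or> q z \<noteq> 0 \<or> w z \<noteq> 0"
    using nv_higgs_bundleD[OF nv[unfolded E]] by blast
  have p0: "p z = 0" if "z \<noteq> 0" for z
    using H0_trivial[OF p multiplier_upper_not_monomial[OF l] that] .
  obtain c i j where c: "c = 0 \<or> ?\<kappa> * inverse h = \<alpha> ^ i * \<beta> ^ j" "\<And>z. z \<noteq> 0 \<Longrightarrow> q z = c * u z ^ i * v z ^ j"
    using H0_cases[OF q] by blast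
  obtain d m n where d: "d = 0 \<or> ?\<kappa> * h = \<alpha> ^ m * \<beta> ^ n" "\<And>z. z \<noteq> 0 \<Longrightarrow> w z = d * u z ^ m * v z ^ n"
    using H0_cases[OF w] by blast
  \<comment> \<open>The product of two nonzero entries would be a section of the squared twist,
    whose multiplier \<open>\<alpha> ^ 2 * inverse (\<beta> ^ (2 * l))\<close> is not a
    monomial.\<close>
  have "c = 0 \<or> d = 0"
  proof (rule ccontr)
    assume "\<not> ?thesis"
    then have "?\<kappa> * inverse h * (?\<kappa> * h) = (\<alpha> ^ i * \<beta> ^ j) * (\<alpha> ^ m * \<beta> ^ n)" using c d by simp
    moreover have "?\<kappa> * inverse h * (?\<kappa> * h) = ?\<kappa> * ?\<kappa>" using h by simp
    ultimately have "\<alpha> ^ 2 * \<beta> ^ 0 = \<alpha> ^ (i + m) * \<beta> ^ (j + n + l + l)"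
      by (simp add: field_simps power_add power2_eq_square)
    then show False using l unfolding monomial_eq_iff by simp
  qed
  moreover have "d \<noteq> 0"
  proof
    assume "d = 0"
    then have "q z \<noteq> 0" if "z \<noteq> 0" for z using pqw[OF that] p0[OF that] d(2)[OF that] by simp
    then have "?\<kappa> * inverse h = 1" using H0_nowhere_vanishing[OF q] by blast
    then have "h = ?\<kappa>" using h(1) by (simp add: field_simps)
    \<comment> \<open>Here \<open>cmod \<alpha> < cmod \<beta> ^ l\<close> puts the modulus of H
      below 1, contrary to deg H <= 0.\<close>
    then show False using h(2) le cmod_upper_ge_1 by simp
  qed
  ultimately have q0: "q z = 0" if "z \<noteq> 0" for z using c(2)[OF that] by simp
  then have "w z \<noteq> 0" if "z \<noteq> 0" for z using pqw[OF that] p0[OF that] that by simp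
  then obtain e where e: "e \<noteq> 0" "?\<kappa> * h = 1" "\<And>z. z \<noteq> 0 \<Longrightarrow> w z = e"
    using H0_nowhere_vanishing[OF w] by blast
  have h_eq: "h = ?h" using e(2) by (simp add: field_simps)
  have "conjugate a b h \<phi> (\<lambda>z. mat2 0 0 1 0)"
  proof (rule conjugate_upperI[of e 1 _ "\<lambda>z. 0"])
    show "mat2 0 0 1 0 ** mat2 e 0 0 1 = mat2 e 0 0 1 ** \<phi> z" if "z \<noteq> 0" for z
      by (rule mat2_eqI) (simp_all add: matrix_mult_2 \<phi>[OF that] p0[OF that] q0[OF that] e(3)[OF that])
  qed (use e h H0_zero_const in auto)
  then have "higgs_equiv a b E (?h, \<lambda>z. mat2 0 0 1 0)"
    using E higgs_equiv_iff h h_eq by simp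
  then show "\<exists>!E'. E' \<in> {(?h, \<lambda>z. mat2 0 0 1 0)} \<and> higgs_equiv a b E E'" by blast
qed

end

theorem proposition5p10:
  fixes a b :: complex
  assumes "generic_hopf a b"
  shows
    "(nv_higgs_classified_by a b a
       ({(inverse a, \<lambda>(x, y). mat2 0 (t * x\<^sup>2) 1 0) | t. True} \<union>
        {(a * inverse (b ^ k), \<lambda>(x, y). mat2 (s * x) (y ^ k) 0 (- (s * x))) | s (k::nat).
           s \<noteq> 0 \<and> real k \<ge> ln (cmod a) / ln (cmod b)} \<union>
        {(b ^ k * inverse a, \<lambda>(x, y). mat2 (s * x) 0 (y ^ k) (- (s * x))) | s (k::nat).
           s \<noteq> 0 \<and> 0 < k \<and> real k < ln (cmod a) / ln (cmod b)})) \<and>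
     (\<forall>t. invariant_subs_are a b (inverse a, \<lambda>(x, y). mat2 0 (t * x\<^sup>2) 1 0)
       {(inverse a, \<lambda>(x, y). vec2 (x * csqrt t) 1), (inverse a, \<lambda>(x, y). vec2 (- x * csqrt t) 1)}) \<and>
     (\<forall>s (k::nat). s \<noteq> 0 \<longrightarrow> real k \<ge> ln (cmod a) / ln (cmod b) \<longrightarrow>
       invariant_subs_are a b
         (a * inverse (b ^ k), \<lambda>(x, y). mat2 (s * x) (y ^ k) 0 (- (s * x)))
         {(1, \<lambda>(x, y). vec2 1 0), (inverse (b ^ k), \<lambda>(x, y). vec2 (y ^ k) (- 2 * s * x))}) \<and>
     (\<forall>s (k::nat). s \<noteq> 0 \<longrightarrow> 0 < k \<longrightarrow> real k < ln (cmod a) / ln (cmod b) \<longrightarrow>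
       invariant_subs_are a b
         (b ^ k * inverse a, \<lambda>(x, y). mat2 (s * x) 0 (y ^ k) (- (s * x)))
         {(b ^ k * inverse a, \<lambda>(x, y). vec2 0 1), (inverse a, \<lambda>(x, y). vec2 (2 * s * x) (y ^ k))}) \<and>
     (nv_higgs_classified_by a b b
       ({(inverse b, \<lambda>(x, y). mat2 0 (t * y\<^sup>2) 1 0) | t. True} \<union>
        {(b * inverse (a ^ k), \<lambda>(x, y). mat2 (s * y) (x ^ k) 0 (- (s * y))) | s (k::nat).
           s \<noteq> 0 \<and> 0 < k})) \<and>
     (\<forall>t. invariant_subs_are a b (inverse b, \<lambda>(x, y). mat2 0 (t * y\<^sup>2) 1 0)
       {(inverse b, \<lambda>(x, y). vec2 (y * csqrt t) 1), (inverse b, \<lambda>(x, y). vec2 (- y * csqrt t) 1)}) \<and>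
     (\<forall>s (k::nat). s \<noteq> 0 \<longrightarrow> 0 < k \<longrightarrow>
       invariant_subs_are a b
         (b * inverse (a ^ k), \<lambda>(x, y). mat2 (s * y) (x ^ k) 0 (- (s * y)))
         {(1, \<lambda>(x, y). vec2 1 0), (inverse (a ^ k), \<lambda>(x, y). vec2 (x ^ k) (- 2 * s * y))}) \<and>
     (\<forall>l::nat. 0 < l \<longrightarrow> real l < ln (cmod a) / ln (cmod b) \<longrightarrow>
       nv_higgs_classified_by a b (a * inverse (b ^ l))
         {(b ^ l * inverse a, \<lambda>(x, y). mat2 0 0 1 0)}) \<and>
     (\<forall>l::nat. 0 < l \<longrightarrow> real l < ln (cmod a) / ln (cmod b) \<longrightarrow>
       invariant_subs_are a b (b ^ l * inverse a, \<lambda>(x, y). mat2 0 0 1 0)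
         {(inverse (a * inverse (b ^ l)), \<lambda>(x, y). vec2 0 1)})"
proof -
  interpret X: hopf_coords a b a b fst snd
    by unfold_locales (use assms in auto)
  interpret Y: hopf_coords a b b a snd fst
    by unfold_locales (use assms in auto)
  have le: "cmod a \<le> cmod b" using assms by (simp add: generic_hopf_def)
  \<comment> \<open>Multiplying by the negative number \<open>ln (cmod b)\<close> reverses the
    inequality.\<close>
  have ge_iff: "ln (cmod a) / ln (cmod b) \<le> real k \<longleftrightarrow> cmod b ^ k \<le> cmod a" for k :: nat
  proof -
    have "ln (cmod a) / ln (cmod b) \<le> real k \<longleftrightarrow> ln (cmod b ^ k) \<le> ln (cmod a)"
      using X.ln_b_neg by (simp add: divide_le_eq ln_realpow)
    then show ?thesis using X.norms by simp
  qed
  have lt_iff: "real k < ln (cmod a) / ln (cmod b) \<longleftrightarrow> cmod a < cmod b ^ k" for k :: nat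
    using ge_iff[of k] by linarith
  have pos: "0 < k" if "cmod b ^ k \<le> cmod a" for k :: nat
    using that X.norms by (cases k) auto
  \<comment> \<open>For the twist by L_b the ordering \<open>cmod a \<le> cmod b\<close> makes the
    degree condition hold for every positive exponent.\<close>
  have swapped: "cmod a ^ k \<le> cmod b \<longleftrightarrow> 0 < k" for k :: nat
  proof
    show "0 < k" if "cmod a ^ k \<le> cmod b" using that X.norms by (cases k) auto
    assume "0 < k"
    then have "cmod a ^ k \<le> cmod a ^ 1" using X.norms by (intro power_decreasing) auto
    then show "cmod a ^ k \<le> cmod b" using le by simp
  qed
  \<comment> \<open>For the same reason the strict inequality of the lower family never holds, so
    that family is empty for L_b.\<close>
  have no_lower: "{(a ^ k * inverse b, \<lambda>z. mat2 (s * snd z) 0 (fst z ^ k) (- (s * snd z))) | s (k::nat).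
      s \<noteq> 0 \<and> 0 < k \<and> cmod b < cmod a ^ k} = {}"
  proof -
    have "\<not> cmod b < cmod a ^ k" if "0 < k" for k :: nat using swapped[of k] that by linarith
    then show ?thesis by blast
  qed
  show ?thesis
    unfolding case_prod_unfold ge_iff lt_iff
  proof (intro conjI allI impI, goal_cases)
    case 1
    show ?case by (rule X.classified_linear)
  next
    case (2 t)
    show ?case by (rule X.invariant_subs_antidiag)
  next
    case (3 s k)
    then show ?case by (intro X.invariant_subs_upper pos)
  next
    case (4 s k)
    then show ?case by (intro X.invariant_subs_lower)
  next
    case 5
    show ?case using Y.classified_linear unfolding no_lower swapped Un_empty_right .
  next
    case (6 t)
    show ?case by (rule Y.invariant_subs_antidiag)
  next
    case (7 s k)
    then show ?case by (intro Y.invariant_subs_upper)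
  next
    case (8 l)
    then show ?case by (intro X.classified_constant)
  next
    \<comment> \<open>The multiplier of the second summand is the inverse of the twist, written in
      two ways.\<close>
    case (9 l)
    show ?case using X.invariant_subs_constant[of "b ^ l * inverse a"] by (simp add: mult.commute)
  qed
qed

end
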